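(* Clique $8$ can be realized over $\mathbb{F}_{19}$: there exist eight points $P_1,\dots,P_8\in\mathbb{P}^2(\mathbb{F}_{19})$ in general position such that the del Pezzo surface of degree $1$ obtained by blowing up $\mathbb{P}^2_{\mathbb{F}_{19}}$ in these points contains ten exceptional curves that all pass through one common point, and whose pairwise intersection numbers are all $1$ or $2$, with the pairs of intersection number $2$ forming the graph on the ten curves that is the disjoint union of three triangles and one isolated vertex.
   Context: Eight points in $\mathbb{P}^2$ are in general position if no line contains three of them, no conic contains six of them, and no cubic contains all eight of them with a singularity at one of them. An exceptional curve on a del Pezzo surface $X$ of degree $1$ is an irreducible curve $C$ with $C^2=C\cdot K_X=-1$. In characteristic $\neq 2,3$ a generalized Eckardt point is a point contained in ten exceptional curves. *)

theory Defs
  imports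
    "HOL-Analysis.Determinants"
    "HOL-Library.Numeral_Type"
    "HOL-Library.Poly_Mapping"
    "HOL-Computational_Algebra.Computational_Algebra"
    "HOL-Algebra.Algebraic_Closure_Type"
    "Berlekamp_Zassenhaus.Finite_Field"
begin

hide_const (open) UnivPoly.coeff UnivPoly.monom Divisibility.irreducible

section \<open>The field with 19 elements\<close>

text \<open>The numeral type \<open>19\<close> cannot be given a sort of its own, so a type with 19 elements is
  introduced as the index of \<open>mod_ring\<close>.\<close>

typedef index19 = "{..<19::nat}" by (rule exI[of _ 0]) simp

lemma card_index19: "CARD(index19) = 19"
  using type_definition.card[OF type_definition_index19] by simp

instance index19 :: prime_card
proof
  have "prime (19::nat)" by simp
  then show "prime (CARD(index19))" by (simp only: card_index19)
qed

type_synonym F19 = "index19 mod_ring"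


section \<open>Forms in three variables\<close>

text \<open>The ring \<open>'a poly poly poly\<close> is \<open>'a[x][y][z]\<close>: the coefficient of \<open>x\<^sup>i y\<^sup>j z\<^sup>k\<close>
  in \<open>F\<close> is \<open>coeff (coeff (coeff F k) j) i\<close>.\<close>

type_synonym 'a poly3 = "'a poly poly poly"

definition coeff3 :: "'a::zero poly3 \<Rightarrow> nat \<Rightarrow> nat \<Rightarrow> nat \<Rightarrow> 'a" where
  "coeff3 F i j k = coeff (coeff (coeff F k) j) i"

definition eval3 :: "'a::comm_semiring_0 poly3 \<Rightarrow> 'a ^ 3 \<Rightarrow> 'a" where
  "eval3 F q = poly (poly (poly F [:[:q $ 3:]:]) [:q $ 2:]) (q $ 1)"

definition map3 :: "('a::zero \<Rightarrow> 'b::zero) \<Rightarrow> 'a poly3 \<Rightarrow> 'b poly3" where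
  "map3 h = map_poly (map_poly (map_poly h))"

definition is_form :: "nat \<Rightarrow> 'a::zero poly3 \<Rightarrow> bool" where
  "is_form d F \<longleftrightarrow> F \<noteq> 0 \<and> (\<forall>i j k. coeff3 F i j k \<noteq> 0 \<longrightarrow> i + j + k = d)"

text \<open>The polynomial \<open>F(q\<^sub>1 + x, q\<^sub>2 + y, q\<^sub>3 + z)\<close>; the multiplicity of the curve \<open>F = 0\<close> at the
  point \<open>q\<close> of the projective plane is its order of vanishing at the origin (the affine cone over
  a curve has, at \<open>q\<close>, the multiplicity that the curve has at the point represented by \<open>q\<close>).\<close>

definition translate3 :: "'a::comm_semiring_1 ^ 3 \<Rightarrow> 'a poly3 \<Rightarrow> 'a poly3" where
  "translate3 q F = eval3 (map3 (\<lambda>c. [:[:[:c:]:]:]) F)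
     (vector [[:[:[:q $ 1, 1:]:]:], [:[:[:q $ 2:], 1:]:], [:[:[:q $ 3:]:], 1:]])"

definition mult_at :: "'a::comm_semiring_1 poly3 \<Rightarrow> 'a ^ 3 \<Rightarrow> nat" where
  "mult_at F q = (LEAST m. \<exists>i j k. i + j + k = m \<and> coeff3 (translate3 q F) i j k \<noteq> 0)"


section \<open>Eight points in general position\<close>

text \<open>Points of the plane are given by nonzero coordinate vectors. Lines, conics and cubics are the
  zero loci of nonzero forms of degree 1, 2, 3 and may be reducible. The first clause forces the
  eight points to be pairwise distinct: two equal ones would lie on a line with any third.\<close>

definition general_position :: "(8 \<Rightarrow> 'a::field ^ 3) \<Rightarrow> bool" where
  "general_position Q \<longleftrightarrow>
     (\<forall>i. Q i \<noteq> 0) \<and>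
     (\<forall>F. is_form 1 F \<longrightarrow> card {i. eval3 F (Q i) = 0} < 3) \<and>
     (\<forall>F. is_form 2 F \<longrightarrow> card {i. eval3 F (Q i) = 0} < 6) \<and>
     (\<forall>F. is_form 3 F \<longrightarrow> \<not> ((\<forall>i. eval3 F (Q i) = 0) \<and> (\<exists>i. mult_at F (Q i) \<ge> 2)))"


section \<open>The blow-up and its curves\<close>

text \<open>The blow-up in the eight points \<open>Q i\<close> is the subvariety of
  \<open>\<P>\<^sup>2 \<times> (\<P>\<^sup>1)\<^sup>8\<close> of all \<open>(p, l)\<close> where \<open>l i\<close> is a line through \<open>Q i\<close> and \<open>p\<close>. Points and lines
  of the plane are taken as one- and two-dimensional subspaces of the three-dimensional space.\<close>

type_synonym 'a blowup_point = "('a ^ 3) set \<times> (8 \<Rightarrow> ('a ^ 3) set)"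

definition blowup :: "(8 \<Rightarrow> 'a::field ^ 3) \<Rightarrow> 'a blowup_point set" where
  "blowup Q = {(p, l). (\<exists>q. q \<noteq> 0 \<and> p = vec.span {q}) \<and>
     (\<forall>i. vec.subspace (l i) \<and> vec.dim (l i) = 2 \<and> Q i \<in> l i \<and> p \<subseteq> l i)}"

text \<open>The irreducible curves on the blow-up are the eight curves \<open>E\<^sub>i\<close> over the points and the
  strict transforms of the irreducible plane curves. A plane curve over \<open>'a\<close> is represented by its
  equation with leading coefficient 1, so that different objects are different curves.\<close>

context notes [[typedef_overloaded]]
begin
datatype 'a curve = Exceptional 8 | Strict "'a poly3"
end

primrec irreducible_curve :: "'a::field curve \<Rightarrow> bool" where
  "irreducible_curve (Exceptional i) \<longleftrightarrow> True"
| "irreducible_curve (Strict F) \<longleftrightarrow>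
     (\<exists>d. is_form d F) \<and> irreducible F \<and> lead_coeff (lead_coeff (lead_coeff F)) = 1"


subsection \<open>Local coordinates and local equations\<close>

text \<open>A frame \<open>(q, v, w)\<close> at a point \<open>(p, l)\<close> of the blow-up is a basis with \<open>p = \<langle>q\<rangle>\<close>, and with
  \<open>l i = \<langle>q, v\<rangle>\<close> in case \<open>p\<close> is the centre \<open>Q i\<close>. It yields local coordinates \<open>(s, t)\<close>, with
  \<open>(p, l)\<close> as origin, in which the map to the plane is
  \<open>q + s v + t w\<close> if \<open>p\<close> is not a centre, and \<open>q + s (v + t w)\<close> if it is one.
  Polynomials in \<open>s, t\<close> are elements of \<open>'a poly poly\<close> with outer variable \<open>s\<close>.\<close>

type_synonym 'a frame = "('a ^ 3) \<times> ('a ^ 3) \<times> ('a ^ 3)"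

definition frame_at :: "(8 \<Rightarrow> 'a::field ^ 3) \<Rightarrow> 'a blowup_point \<Rightarrow> 'a frame \<Rightarrow> bool" where
  "frame_at Q = (\<lambda>(p, l) (q, v, w). p = vec.span {q} \<and> det (vector [q, v, w] :: 'a ^ 3 ^ 3) \<noteq> 0 \<and>
     (\<forall>i. p = vec.span {Q i} \<longrightarrow> l i = vec.span {q, v}))"

definition coord_s :: "'a::comm_semiring_1 poly poly" where "coord_s = [:0, 1:]"

definition coord_t :: "'a::comm_semiring_1 poly poly" where "coord_t = [:[:0, 1:]:]"

definition is_centre :: "(8 \<Rightarrow> 'a::field ^ 3) \<Rightarrow> 'a ^ 3 \<Rightarrow> bool" where
  "is_centre Q q \<longleftrightarrow> (\<exists>i. vec.span {q} = vec.span {Q i})"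

definition chart :: "(8 \<Rightarrow> 'a::field ^ 3) \<Rightarrow> 'a frame \<Rightarrow> 'a poly poly ^ 3" where
  "chart Q = (\<lambda>(q, v, w). \<chi> j. [:[:q $ j:]:] + coord_s * [:[:v $ j:]:] +
     (if is_centre Q q then coord_s * coord_t else coord_t) * [:[:w $ j:]:])"

definition total_transform ::
    "(8 \<Rightarrow> 'a::field ^ 3) \<Rightarrow> 'a frame \<Rightarrow> 'a poly3 \<Rightarrow> 'a poly poly" where
  "total_transform Q B F = eval3 (map3 (\<lambda>c. [:[:c:]:]) F) (chart Q B)"

text \<open>Over a centre, the exceptional curve is \<open>s = 0\<close>, and the strict transform of a curve is the
  total transform with the exceptional curve removed as often as the multiplicity says (an exact
  division).\<close>

primrec local_equation ::
    "(8 \<Rightarrow> 'a::field ^ 3) \<Rightarrow> 'a frame \<Rightarrow> 'a curve \<Rightarrow> 'a poly poly" where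
  "local_equation Q B (Exceptional i) =
     (if vec.span {fst B} = vec.span {Q i} then coord_s else 1)"
| "local_equation Q B (Strict F) =
     total_transform Q B F div (if is_centre Q (fst B) then coord_s ^ mult_at F (fst B) else 1)"


subsection \<open>Geometric points of curves\<close>

definition geometric_points :: "(8 \<Rightarrow> 'a::field ^ 3) \<Rightarrow> 8 \<Rightarrow> 'a alg_closure ^ 3" where
  "geometric_points P i = (\<chi> j. to_ac (P i $ j))"

primrec geometric_curve :: "'a::field curve \<Rightarrow> 'a alg_closure curve" where
  "geometric_curve (Exceptional i) = Exceptional i"
| "geometric_curve (Strict F) = Strict (map3 to_ac F)"

definition geometric_equation ::
    "(8 \<Rightarrow> 'a::field ^ 3) \<Rightarrow> 'a alg_closure frame \<Rightarrow> 'a curve \<Rightarrow> 'a alg_closure poly poly" where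
  "geometric_equation P B C = local_equation (geometric_points P) B (geometric_curve C)"

definition geometric_blowup :: "(8 \<Rightarrow> 'a::field ^ 3) \<Rightarrow> 'a alg_closure blowup_point set" where
  "geometric_blowup P = blowup (geometric_points P)"

definition curve_points ::
    "(8 \<Rightarrow> 'a::field ^ 3) \<Rightarrow> 'a curve \<Rightarrow> 'a alg_closure blowup_point set" where
  "curve_points P C = {x \<in> geometric_blowup P. \<exists>B. frame_at (geometric_points P) x B \<and>
     coeff (coeff (geometric_equation P B C) 0) 0 = 0}"

text \<open>Two curves meet transversally if at each common geometric point the linear parts of their
  local equations are linearly independent. (For plane curves over a perfect field the local
  equations are reduced.)\<close>

definition meet_transversally :: "(8 \<Rightarrow> 'a::field ^ 3) \<Rightarrow> 'a curve \<Rightarrow> 'a curve \<Rightarrow> bool" where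
  "meet_transversally P C D \<longleftrightarrow>
     (\<forall>x \<in> curve_points P C \<inter> curve_points P D. \<exists>B. frame_at (geometric_points P) x B \<and>
        (let f = geometric_equation P B C; g = geometric_equation P B D
         in coeff (coeff f 1) 0 * coeff (coeff g 0) 1 - coeff (coeff f 0) 1 * coeff (coeff g 1) 0 \<noteq> 0))"


section \<open>Divisors and the intersection pairing\<close>

type_synonym 'a divisor = "'a curve \<Rightarrow>\<^sub>0 int"

definition divisors :: "'a::field_gcd divisor set" where
  "divisors = {D. Poly_Mapping.keys D \<subseteq> Collect irreducible_curve}"

primrec ord_along :: "(8 \<Rightarrow> 'a::field_gcd ^ 3) \<Rightarrow> 'a curve \<Rightarrow> 'a poly3 \<Rightarrow> nat" where
  "ord_along P (Exceptional i) F = mult_at F (P i)"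
| "ord_along P (Strict H) F = multiplicity H F"

text \<open>The effective divisor cut out on the blow-up by the pullback of a form.\<close>

definition is_div_of_form :: "(8 \<Rightarrow> 'a::field_gcd ^ 3) \<Rightarrow> 'a poly3 \<Rightarrow> 'a divisor \<Rightarrow> bool" where
  "is_div_of_form P F D \<longleftrightarrow> D \<in> divisors \<and>
     (\<forall>C. irreducible_curve C \<longrightarrow> Poly_Mapping.lookup D C = int (ord_along P C F))"

text \<open>The rational functions on the blow-up, which are those on the plane, are the quotients of two
  forms of the same degree.\<close>

definition linearly_equivalent :: "(8 \<Rightarrow> 'a::field_gcd ^ 3) \<Rightarrow> 'a divisor \<Rightarrow> 'a divisor \<Rightarrow> bool" where
  "linearly_equivalent P D D' \<longleftrightarrow>
     (\<exists>d F G A B. is_form d F \<and> is_form d G \<and> is_div_of_form P F A \<and> is_div_of_form P G B \<and>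
        D - D' = A - B)"

text \<open>The axioms that determine the intersection pairing of divisors on a smooth projective surface
  uniquely (Hartshorne, Algebraic Geometry, Theorem V.1.1).\<close>

definition intersection_pairing ::
    "(8 \<Rightarrow> 'a::field_gcd ^ 3) \<Rightarrow> ('a divisor \<Rightarrow> 'a divisor \<Rightarrow> int) \<Rightarrow> bool" where
  "intersection_pairing P I \<longleftrightarrow>
     (\<forall>C D. irreducible_curve C \<and> irreducible_curve D \<and> meet_transversally P C D \<longrightarrow>
        I (frag_of C) (frag_of D) = int (card (curve_points P C \<inter> curve_points P D))) \<and>
     (\<forall>D \<in> divisors. \<forall>E \<in> divisors. I D E = I E D) \<and>
     (\<forall>D \<in> divisors. \<forall>D' \<in> divisors. \<forall>E \<in> divisors. I (D + D') E = I D E + I D' E) \<and>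
     (\<forall>D \<in> divisors. \<forall>D' \<in> divisors. \<forall>E \<in> divisors.
        linearly_equivalent P D D' \<longrightarrow> I D E = I D' E)"

text \<open>For a cubic form \<open>h\<close>, the differential \<open>(x dy dz + y dz dx + z dx dy) / h\<close> is a
  rational 2-form on the plane. In the local coordinates above its numerator pulls back to
  \<open>det (A, \<partial>A/\<partial>s, \<partial>A/\<partial>t) ds dt\<close>, where \<open>A\<close> is the chart; this determinant is \<open>det (q, v, w)\<close> away from
  the centres and \<open>s det (q, v, w)\<close> over them. So the divisor of the differential is the sum
  of the eight exceptional curves minus the divisor of \<open>h\<close>.\<close>

definition canonical_divisor :: "(8 \<Rightarrow> 'a::field_gcd ^ 3) \<Rightarrow> 'a divisor \<Rightarrow> bool" where
  "canonical_divisor P K \<longleftrightarrow>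
     (\<exists>h A. is_form 3 h \<and> is_div_of_form P h A \<and> K = (\<Sum>i\<in>UNIV. frag_of (Exceptional i)) - A)"

definition exceptional_curve ::
    "(8 \<Rightarrow> 'a::field_gcd ^ 3) \<Rightarrow> ('a divisor \<Rightarrow> 'a divisor \<Rightarrow> int) \<Rightarrow> 'a curve \<Rightarrow> bool" where
  "exceptional_curve P I C \<longleftrightarrow> irreducible_curve C \<and> I (frag_of C) (frag_of C) = -1 \<and>
     (\<exists>K. canonical_divisor P K \<and> I (frag_of C) K = -1)"


section \<open>The graph of clique 8\<close>

definition three_triangles_and_isolated_vertex :: "'v set \<Rightarrow> ('v \<Rightarrow> 'v \<Rightarrow> bool) \<Rightarrow> bool" where
  "three_triangles_and_isolated_vertex V adj \<longleftrightarrow>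
     (\<exists>T1 T2 T3 v. V = T1 \<union> T2 \<union> T3 \<union> {v} \<and>
        card T1 = 3 \<and> card T2 = 3 \<and> card T3 = 3 \<and>
        T1 \<inter> T2 = {} \<and> T1 \<inter> T3 = {} \<and> T2 \<inter> T3 = {} \<and> v \<notin> T1 \<union> T2 \<union> T3 \<and>
        (\<forall>a\<in>V. \<forall>b\<in>V. a \<noteq> b \<longrightarrow> (adj a b \<longleftrightarrow> (\<exists>T\<in>{T1, T2, T3}. a \<in> T \<and> b \<in> T))))"

end

theory Submission
  imports Defs
begin

text \<open>In the Picard lattice the classes \<open>e + K\<close> of the exceptional curves are the roots of \<open>E\<^sub>8\<close>, and
  \<open>e \<cdot> e' = 2\<close> means that the two roots span an \<open>A\<^sub>2\<close>. Hence the ten classes come from the positions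
  \<open>3 A\<^sub>2 + A\<^sub>1\<close> in \<open>E\<^sub>8\<close>. The position is chosen such that the plane degrees stay small: six cubics with
  a double point at \<open>P\<^sub>i\<close> that miss \<open>P\<^sub>j\<close>, with \<open>(i, j)\<close> running through two 3-cycles; two quartics
  with three double points and the line through \<open>P\<^sub>7, P\<^sub>8\<close>; and a seventh cubic, for the pair
  \<open>(7, 8)\<close>. A computer search over the field with 19 elements found eight points for which these ten
  curves are concurrent, with coordinates such that all equations are monic in \<open>z\<close> and stay irreducible
  on the line \<open>x = y\<close>; this gives the irreducibility.

  The intersection numbers follow from the axioms of the pairing once those of the line class \<open>H\<close> and
  the \<open>E\<^sub>i\<close> are known. For \<open>H\<^sup>2\<close> two transversal lines that avoid the eight points are used, and for
  \<open>E\<^sub>i\<^sup>2\<close> a line that passes through \<open>P\<^sub>i\<close> only.\<close>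

no_notation fps_nth (infixl \<open>$\<close> 75)

section \<open>Forms as coefficient lists\<close>

text \<open>This fixes the order of all coefficient lists: lexicographic in (i, j), so the
  coefficient of \<open>z ^ d\<close> comes first. The same lists also run over the multi-indices of
  derivatives of a given order.\<close>

definition exponents :: "nat \<Rightarrow> (nat \<times> nat \<times> nat) list" where
  "exponents d = concat (map (\<lambda>i. map (\<lambda>j. (i, j, d - (i + j))) [0..<Suc (d - i)]) [0..<Suc d])"

fun mono3 :: "'a::zero \<Rightarrow> nat \<times> nat \<times> nat \<Rightarrow> 'a poly3" where
  "mono3 c (i, j, k) = monom (monom (monom c i) j) k"

definition form_of :: "nat \<Rightarrow> 'a::comm_monoid_add list \<Rightarrow> 'a poly3" where
  "form_of d cs = (\<Sum>(c, t)\<leftarrow>zip cs (exponents d). mono3 c t)"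

definition dot :: "'a::semiring_0 list \<Rightarrow> 'a list \<Rightarrow> 'a" where
  "dot cs rs = (\<Sum>(c, r)\<leftarrow>zip cs rs. c * r)"

text \<open>The value at \<open>(x, y, z)\<close> of a Hasse derivative of a monomial; no factorials appear, so it gives
  the Taylor coefficient in every characteristic.\<close>

fun jet :: "'a::comm_semiring_1 \<times> 'a \<times> 'a \<Rightarrow> nat \<times> nat \<times> nat \<Rightarrow> nat \<times> nat \<times> nat \<Rightarrow> 'a" where
  "jet (x, y, z) (a, b, c) (i, j, k) =
     of_nat ((i choose a) * (j choose b) * (k choose c)) * (x ^ (i - a) * y ^ (j - b) * z ^ (k - c))"

lemma set_exponents: "set (exponents d) = {(i, j, k). i + j + k = d}"
proof -
  have "(i, j, k) \<in> set (exponents d) \<longleftrightarrow> i + j + k = d" for i j k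
    by (auto simp: exponents_def image_iff simp del: upt_Suc)
  then show ?thesis by auto
qed

lemma distinct_exponents: "distinct (exponents d)"
  unfolding exponents_def
  by (intro distinct_concat)
    (auto simp: distinct_map inj_on_def hd_map simp del: upt_Suc dest!: arg_cong[of _ _ hd])

lemma coeff3_simps [simp]:
  "coeff3 0 i j k = 0"
  "coeff3 (F + G) i j k = coeff3 F i j k + coeff3 G i j k"
  by (simp_all add: coeff3_def)

lemma coeff3_mono3 [simp]: "coeff3 (mono3 c t) i j k = (if t = (i, j, k) then c else 0)"
  by (cases t) (auto simp: coeff3_def)

lemma poly3_eqI: "(\<And>i j k. coeff3 F i j k = coeff3 G i j k) \<Longrightarrow> F = G"
  by (intro poly_eqI) (simp add: coeff3_def)

text \<open>Coefficients, values, translates, changes of scalars and restrictions to a line are all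
  additive, so each of them is computed on monomials through this one principle.\<close>

lemma additive_form_of:
  assumes "\<phi> 0 = 0" "\<And>F G. \<phi> (F + G) = \<phi> F + \<phi> G"
  shows "\<phi> (form_of d cs) = (\<Sum>(c, t)\<leftarrow>zip cs (exponents d). \<phi> (mono3 c t))"
proof -
  have "\<phi> (\<Sum>(c, t)\<leftarrow>l. mono3 c t) = (\<Sum>(c, t)\<leftarrow>l. \<phi> (mono3 c t))" for l
    using assms by (induction l) auto
  then show ?thesis by (simp add: form_of_def)
qed

text \<open>Turns statements about all forms of degree d into statements about finite vectors of
  coefficients, and so general position into linear algebra.\<close>

lemma is_form_eq_form_of:
  assumes "is_form d F"
  shows "F = form_of d (map (\<lambda>(i, j, k). coeff3 F i j k) (exponents d))"
proof (rule poly3_eqI)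
  fix i j k
  let ?c = "\<lambda>(i, j, k). coeff3 F i j k"
  have "coeff3 (form_of d (map ?c (exponents d))) i j k
      = (\<Sum>(c, t)\<leftarrow>zip (map ?c (exponents d)) (exponents d). coeff3 (mono3 c t) i j k)"
    by (rule additive_form_of) simp_all
  also have "\<dots> = (\<Sum>t\<leftarrow>exponents d. if t = (i, j, k) then ?c t else 0)"
    by (auto simp: zip_map1 zip_same_conv_map comp_def intro!: arg_cong[of _ _ sum_list])
  also have "\<dots> = (\<Sum>t\<in>set (exponents d). if t = (i, j, k) then ?c t else 0)"
    using distinct_exponents by (rule sum_list_distinct_conv_sum_set)
  also have "\<dots> = coeff3 F i j k"
    using assms unfolding sum.delta[OF finite_set] by (auto simp: is_form_def set_exponents)
  finally show "coeff3 F i j k = coeff3 (form_of d (map ?c (exponents d))) i j k" by simp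
qed

lemma coeff3_form_of_eq_0:
  assumes "i + j + k \<noteq> d"
  shows "coeff3 (form_of d cs) i j k = 0"
proof -
  have "coeff3 (form_of d cs) i j k = (\<Sum>(c, t)\<leftarrow>zip cs (exponents d). coeff3 (mono3 c t) i j k)"
    by (rule additive_form_of) simp_all
  also have "\<dots> = (\<Sum>x\<leftarrow>zip cs (exponents d). 0)"
    using assms set_exponents[of d]
    by (intro arg_cong[of _ _ sum_list] map_cong) (auto dest!: set_zip_rightD)
  finally show ?thesis by simp
qed

section \<open>Evaluation, change of scalars and Taylor expansion of forms\<close>

lemma eval3_simps [simp]:
  "eval3 0 q = 0"
  "eval3 (F + G) q = eval3 F q + eval3 G q"
  by (simp_all add: eval3_def)

lemma eval3_mono3: "eval3 (mono3 (c :: 'a::comm_semiring_1) (i, j, k)) q = c * q $ 1 ^ i * q $ 2 ^ j * q $ 3 ^ k"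
  by (simp add: eval3_def poly_monom poly_const_pow mult_ac)

lemma map3_simps:
  assumes "h 0 = 0" "\<And>x y. h (x + y) = h x + h y"
  shows "map3 h 0 = 0" "map3 h (F + G) = map3 h F + map3 h G" "map3 h (mono3 c t) = mono3 (h c) t"
  using assms
  by (cases t; auto simp: map3_def map_poly_monom intro!: poly_eqI simp: coeff_map_poly)+

lemma map3_form_of:
  assumes "h 0 = 0" "\<And>x y. h (x + y) = h x + h y"
  shows "map3 h (form_of d cs) = form_of d (map h cs)"
proof -
  have "map3 h (form_of d cs) = (\<Sum>(c, t)\<leftarrow>zip cs (exponents d). map3 h (mono3 c t))"
    by (rule additive_form_of) (simp_all add: assms map3_simps[where h = h])
  then show ?thesis
    by (simp add: form_of_def zip_map1 split_def comp_def map3_simps[where h = h, OF assms])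
qed

lemma coeff_binomial_power:
  "coeff ([:a :: 'a::comm_semiring_1, 1:] ^ n) b = of_nat (n choose b) * a ^ (n - b)"
proof (cases "b \<le> n")
  case False
  then show ?thesis using degree_linear_power[of a n] by (simp add: coeff_eq_0 binomial_eq_0)
qed (simp add: coeff_linear_poly_power)

lemma coeff_binomial_power_const:
  fixes q :: "'a::comm_semiring_1"
  shows "coeff ([:[:q:], 1:] ^ n) b = [:of_nat (n choose b) * q ^ (n - b):]"
    and "coeff ([:[:[:q:]:], 1:] ^ n) b = [:[:of_nat (n choose b) * q ^ (n - b):]:]"
  by (simp_all add: coeff_binomial_power poly_const_pow of_nat_poly mult.commute)

text \<open>The translated monomial is a product of powers of three binomials, one on each level of
  the nested polynomial ring, so its coefficients are products of three binomial terms.\<close>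

lemma coeff3_translate3_mono3:
  "coeff3 (translate3 q (mono3 f t)) a b c = f * jet (q $ 1, q $ 2, q $ 3) (a, b, c) t"
proof -
  obtain i j k where t: "t = (i, j, k)" by (cases t) auto
  have "translate3 q (mono3 f t) =
      [:[:[:f:]:]:] * [:[:[:q $ 1, 1:]:]:] ^ i * [:[:[:q $ 2:], 1:]:] ^ j * [:[:[:q $ 3:]:], 1:] ^ k"
    unfolding translate3_def t
    by (subst map3_simps(3)) (auto simp: eval3_mono3 simp del: mono3.simps)
  also have "\<dots> = smult (smult [:f:] [:[:q $ 1, 1:] ^ i:] * [:[:q $ 2:], 1:] ^ j)
      ([:[:[:q $ 3:]:], 1:] ^ k)"
    by (simp add: poly_const_pow)
  finally show ?thesis
    by (simp add: coeff3_def t coeff_binomial_power_const(2)[of "q $ 3"]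
          coeff_binomial_power_const(1)[of "q $ 2"])
      (simp add: coeff_binomial_power mult_ac)
qed

lemma translate3_simps [simp]:
  "translate3 q 0 = 0" "translate3 q (F + G) = translate3 q F + translate3 q G"
  unfolding translate3_def by (subst map3_simps; simp)+

text \<open>Every Taylor coefficient is a linear functional of the coefficient list; a multiplicity
  condition is thus a system of linear equations.\<close>

lemma coeff3_translate3_form_of:
  "coeff3 (translate3 q (form_of d cs)) a b c
    = dot cs (map (jet (q $ 1, q $ 2, q $ 3) (a, b, c)) (exponents d))"
proof -
  have "coeff3 (translate3 q (form_of d cs)) a b c
      = (\<Sum>(f, t)\<leftarrow>zip cs (exponents d). coeff3 (translate3 q (mono3 f t)) a b c)"
    by (rule additive_form_of) simp_all
  then show ?thesis
    by (simp add: coeff3_translate3_mono3 dot_def zip_map2 split_def comp_def)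
qed

lemma eval3_form_of:
  "eval3 (form_of d cs) q = dot cs (map (jet (q $ 1, q $ 2, q $ 3) (0, 0, 0)) (exponents d))"
proof -
  have "eval3 (form_of d cs) q = (\<Sum>(f, t)\<leftarrow>zip cs (exponents d). eval3 (mono3 f t) q)"
    by (rule additive_form_of) simp_all
  moreover have "eval3 (mono3 f t) q = f * jet (q $ 1, q $ 2, q $ 3) (0, 0, 0) t" for f t
    by (cases t) (simp add: eval3_mono3 algebra_simps del: mono3.simps)
  ultimately show ?thesis
    by (simp add: dot_def zip_map2 split_def comp_def)
qed

lemma of_int_dot: "of_int (dot cs rs) = (dot (map of_int cs) (map of_int rs) :: 'a::comm_ring_1)"
  by (induction cs rs rule: list_induct2') (auto simp: dot_def)

lemma of_int_jet:
  "of_int (jet (x, y, z) e t) = (jet (of_int x, of_int y, of_int z) e t :: 'a::comm_ring_1)"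
  by (cases e; cases t) simp

section \<open>General position\<close>

text \<open>Integer triples serve as coordinates over every ring, so one computation modulo 19 is
  valid over the field with 19 elements and over its algebraic closure.\<close>

fun int_point :: "int \<times> int \<times> int \<Rightarrow> 'a::ring_1 ^ 3" where
  "int_point (x, y, z) = vector [of_int x, of_int y, of_int z]"

text \<open>Gaussian elimination modulo \<open>p\<close>, without divisions.\<close>

fun trivial_kernel :: "int \<Rightarrow> nat \<Rightarrow> int list list \<Rightarrow> bool" where
  "trivial_kernel p 0 R = True"
| "trivial_kernel p (Suc n) R =
     (case filter (\<lambda>r. hd r mod p \<noteq> 0) R of
        [] \<Rightarrow> False
      | r # _ \<Rightarrow> trivial_kernel p n
          (map (\<lambda>s. map2 (\<lambda>x y. (hd r * y - hd s * x) mod p) (tl r) (tl s)) R))"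

lemma dot_Nil [simp]: "dot [] rs = 0" "dot cs [] = 0"
  by (simp_all add: dot_def)

lemma dot_Cons [simp]: "dot (c # cs) (r # rs) = c * r + dot cs rs"
  by (simp add: dot_def)

text \<open>The reduction modulo the characteristic keeps the integers small and is invisible after
  \<open>of_int\<close>.\<close>

lemma dot_elimination:
  fixes cs :: "'a::comm_ring_1 list"
  assumes "length xs = length cs" "length ys = length cs"
  shows "dot cs (map of_int (map2 (\<lambda>x y. (a * y - b * x) mod int CHAR('a)) xs ys)) =
    of_int a * dot cs (map of_int ys) - of_int b * dot cs (map of_int xs)"
  using assms
proof (induction cs arbitrary: xs ys)
  case (Cons c cs)
  then obtain x xs' y ys' where "xs = x # xs'" "ys = y # ys'" 
    by (metis Suc_length_conv)
  with Cons show ?case by (simp add: algebra_simps)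
qed simp

text \<open>The first unknown cancels in the rows of the next stage, so by induction all later
  unknowns vanish. The pivot row, whose head is nonzero in the field, then kills the first
  one.\<close>

lemma trivial_kernelD:
  fixes cs :: "'a::idom list"
  assumes "trivial_kernel (int CHAR('a)) n R" "length cs = n"
    and "\<And>r. r \<in> set R \<Longrightarrow> length r = n \<and> dot cs (map of_int r) = 0"
  shows "\<forall>c\<in>set cs. c = 0"
  using assms
proof (induction n arbitrary: R cs)
  case (Suc n)
  let ?p = "int CHAR('a)"
  from Suc.prems(1) obtain r l where r: "filter (\<lambda>r. hd r mod ?p \<noteq> 0) R = r # l"
    and IH: "trivial_kernel ?p n
      (map (\<lambda>s. map2 (\<lambda>x y. (hd r * y - hd s * x) mod ?p) (tl r) (tl s)) R)"
    by (auto split: list.splits)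
  have r': "r \<in> set R" "hd r mod ?p \<noteq> 0"
    using arg_cong[OF r, of "\<lambda>l. r \<in> set l"] by simp_all
  obtain c cs' where cs: "cs = c # cs'" "length cs' = n"
    using Suc.prems(2) by (auto simp: length_Suc_conv)
  have split: "\<exists>a s'. s = a # s' \<and> length s' = n \<and> c * of_int a + dot cs' (map of_int s') = 0"
    if "s \<in> set R" for s
    using Suc.prems(3)[OF that] cs by (auto simp: length_Suc_conv)
  obtain a r'' where a: "r = a # r''" "length r'' = n" "c * of_int a + dot cs' (map of_int r'') = 0"
    using split[OF r'(1)] by auto
  have "\<forall>x\<in>set cs'. x = 0"
  proof (rule Suc.IH[OF IH cs(2)])
    fix t
    assume "t \<in> set (map (\<lambda>s. map2 (\<lambda>x y. (hd r * y - hd s * x) mod ?p) (tl r) (tl s)) R)"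
    then obtain s where s: "s \<in> set R"
      "t = map2 (\<lambda>x y. (hd r * y - hd s * x) mod ?p) (tl r) (tl s)" by auto
    obtain b s' where b: "s = b # s'" "length s' = n" "c * of_int b + dot cs' (map of_int s') = 0"
      using split[OF s(1)] by auto
    have "dot cs' (map of_int s') = - c * of_int b" "dot cs' (map of_int r'') = - c * of_int a"
      using a(3) b(3) by (simp_all add: eq_neg_iff_add_eq_0 add.commute)
    then show "length t = n \<and> dot cs' (map of_int t) = 0"
      unfolding s(2) using a b cs(2)
      by (subst dot_elimination) simp_all
  qed
  moreover from this have "dot cs' rs = 0" for rs
    by (induction cs' rs rule: list_induct2') auto
  moreover have "of_int a \<noteq> (0 :: 'a)"
    using r'(2) a(1) by (simp add: of_int_eq_0_iff_char_dvd dvd_eq_mod_eq_0)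
  ultimately show ?case using a(3) cs by auto
qed simp

section \<open>Vanishing conditions on forms as linear systems\<close>

definition condition_rows :: "nat \<Rightarrow> ((int \<times> int \<times> int) \<times> (nat \<times> nat \<times> nat)) list \<Rightarrow> int list list" where
  "condition_rows d L = map (\<lambda>(q, e). map (jet q e) (exponents d)) L"

definition no_form :: "int \<Rightarrow> nat \<Rightarrow> ((int \<times> int \<times> int) \<times> (nat \<times> nat \<times> nat)) list \<Rightarrow> bool" where
  "no_form p d L \<longleftrightarrow> trivial_kernel p (length (exponents d)) (condition_rows d L)"

lemma coeff3_translate3_int_point:
  fixes cs :: "'a::comm_ring_1 list"
  shows "coeff3 (translate3 (int_point q) (form_of d cs)) a b c =
    dot cs (map of_int (map (jet q (a, b, c)) (exponents d)))"
  by (cases q) (simp add: coeff3_translate3_form_of of_int_jet comp_def)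

lemma eval3_form_of_eq_translate3:
  "eval3 (form_of d cs) q = coeff3 (translate3 q (form_of d cs)) 0 0 0"
  by (simp add: eval3_form_of coeff3_translate3_form_of)

lemma eval3_form_eq_translate3: "is_form d F \<Longrightarrow> eval3 F q = coeff3 (translate3 q F) 0 0 0"
  using is_form_eq_form_of[of d F] eval3_form_of_eq_translate3 by metis

text \<open>A form that satisfies all listed conditions has its coefficient list in the kernel, so
  all coefficients vanish; but forms are nonzero by definition.\<close>

lemma no_formD:
  fixes F :: "'a::field poly3"
  assumes "no_form (int CHAR('a)) d L" "is_form d F"
  shows "\<exists>(q, a, b, c) \<in> set L. coeff3 (translate3 (int_point q) F) a b c \<noteq> 0"
proof (rule ccontr)
  assume *: "\<not> ?thesis"
  define cs where "cs = map (\<lambda>(i, j, k). coeff3 F i j k) (exponents d)"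
  have F: "F = form_of d cs"
    unfolding cs_def using assms(2) by (rule is_form_eq_form_of)
  have "\<forall>c\<in>set cs. c = 0"
  proof (rule trivial_kernelD)
    show "trivial_kernel (int CHAR('a)) (length (exponents d)) (condition_rows d L)"
      using assms(1) by (simp add: no_form_def)
    show "length cs = length (exponents d)" by (simp add: cs_def)
    fix r assume "r \<in> set (condition_rows d L)"
    then obtain q a b c where "(q, a, b, c) \<in> set L" "r = map (jet q (a, b, c)) (exponents d)"
      by (auto simp: condition_rows_def)
    with * show "length r = length (exponents d) \<and> dot cs (map of_int r) = 0"
      by (fastforce simp: F coeff3_translate3_int_point)
  qed
  then have "coeff3 F i j k = 0" if "i + j + k = d" for i j k
    using that by (auto simp: cs_def set_exponents)
  then have "coeff3 F i j k = 0" for i j k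
    using assms(2) unfolding is_form_def by blast
  then have "F = 0" by (intro poly3_eqI) simp
  then show False using assms(2) by (simp add: is_form_def)
qed

lemma mult_at_ge_2D:
  assumes "mult_at F q \<ge> 2" "a + b + c < 2"
  shows "coeff3 (translate3 q F) a b c = 0"
  using not_less_Least[of "a + b + c" "\<lambda>m. \<exists>i j k. i + j + k = m \<and> coeff3 (translate3 q F) i j k \<noteq> 0"]
    assms unfolding mult_at_def by auto

text \<open>The exact sizes 3 and 6 suffice, since a larger set of points contains such a subset.
  For cubics the rows are the values at all eight points and the three first-order coefficients at
  the supposed singular point.\<close>

definition in_general_position :: "int \<Rightarrow> (int \<times> int \<times> int) list \<Rightarrow> bool" where
  "in_general_position p ps \<longleftrightarrow>
     (\<forall>(x, y, z)\<in>set ps. z = 1) \<and>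
     (\<forall>T\<in>set (filter (\<lambda>T. length T = 3) (subseqs [0..<8])).
        no_form p 1 (map (\<lambda>n. (ps ! n, 0, 0, 0)) T)) \<and>
     (\<forall>T\<in>set (filter (\<lambda>T. length T = 6) (subseqs [0..<8])).
        no_form p 2 (map (\<lambda>n. (ps ! n, 0, 0, 0)) T)) \<and>
     (\<forall>q\<in>set ps. no_form p 3
        ([(q, 1, 0, 0), (q, 0, 1, 0), (q, 0, 0, 1)] @ map (\<lambda>q. (q, 0, 0, 0)) ps))"

text \<open>Only the characteristic of the field enters, since the rank of a matrix does not change
  under field extension. So a check modulo 19 gives general position over the algebraic
  closure.\<close>

lemma general_position_int_points:
  fixes idx :: "8 \<Rightarrow> nat"
  assumes gp: "in_general_position (int CHAR('a::field)) ps" "length ps = 8"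
    and idx: "bij_betw idx UNIV {..<8}"
  shows "general_position (\<lambda>i. int_point (ps ! idx i) :: 'a ^ 3)"
proof -
  let ?Q = "\<lambda>i. int_point (ps ! idx i) :: 'a ^ 3"
  let ?p = "int CHAR('a)"
  have range_idx: "idx i < 8" for i
    using idx by (auto simp: bij_betw_def)
  have in_ps: "ps ! idx i \<in> set ps" for i
    using range_idx[of i] gp(2) by simp
  \<comment> \<open>Of the points on the curve exactly \<open>k\<close> are chosen; their indices
    form, in increasing order, one of the lists in \<open>subseqs [0..<8]\<close>.\<close>
  have bound: "card {i. eval3 F (?Q i) = 0} < k"
    if F: "is_form d F"
      and k: "\<And>T. T \<in> set (subseqs [0..<8]) \<Longrightarrow> length T = k \<Longrightarrow>
        no_form ?p d (map (\<lambda>n. (ps ! n, 0, 0, 0)) T)" for d k F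
  proof (rule ccontr)
    assume "\<not> card {i. eval3 F (?Q i) = 0} < k"
    then obtain S where S: "S \<subseteq> {i. eval3 F (?Q i) = 0}" "card S = k"
      by (metis leI obtain_subset_with_card_n)
    have "idx ` S \<in> set ` set (subseqs [0..<8])"
      using range_idx by (auto simp: subseqs_powset)
    then obtain T where T: "T \<in> set (subseqs [0..<8])" "set T = idx ` S" by auto
    have "distinct T" using T(1) subseqs_distinctD by fastforce
    moreover have "card (idx ` S) = card S"
      using idx by (intro card_image) (auto simp: bij_betw_def inj_on_def)
    ultimately have "length T = k" using S(2) T(2) by (metis distinct_card)
    from no_formD[OF k[OF T(1) this] F] have "\<exists>(q, a, b, c) \<in> set (map (\<lambda>n. (ps ! n, 0, 0, 0)) T).
        coeff3 (translate3 (int_point q) F) a b c \<noteq> 0"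
      .
    then obtain n where "n \<in> set T" "eval3 F (int_point (ps ! n) :: 'a ^ 3) \<noteq> 0"
      by (auto simp: eval3_form_eq_translate3[OF F])
    then show False using S(1) T(2) by auto
  qed
  have "?Q i \<noteq> 0" for i
  proof -
    obtain x y z where q: "ps ! idx i = (x, y, z)" by (cases "ps ! idx i")
    with in_ps[of i] gp(1) have "z = 1" by (auto simp: in_general_position_def)
    then have "?Q i $ 3 = 1" by (simp add: q)
    then show ?thesis by auto
  qed
  moreover have "\<not> ((\<forall>i. eval3 F (?Q i) = 0) \<and> (\<exists>i. mult_at F (?Q i) \<ge> 2))"
    if F: "is_form 3 F" for F
  proof
    assume "(\<forall>i. eval3 F (?Q i) = 0) \<and> (\<exists>i. mult_at F (?Q i) \<ge> 2)"
    then obtain i where i: "\<And>i. eval3 F (?Q i) = 0" "mult_at F (?Q i) \<ge> 2" by blast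
    let ?q = "ps ! idx i"
    have "\<exists>(q, a, b, c) \<in> set ([(?q, 1, 0, 0), (?q, 0, 1, 0), (?q, 0, 0, 1)] @
        map (\<lambda>q. (q, 0, 0, 0)) ps). coeff3 (translate3 (int_point q) F) a b c \<noteq> 0"
      by (rule no_formD[OF _ F]) (use gp(1) in_ps in \<open>simp add: in_general_position_def\<close>)
    moreover have "coeff3 (translate3 (int_point q) F) 0 0 0 = 0" if q: "q \<in> set ps" for q
    proof -
      obtain n where n: "n < length ps" "ps ! n = q"
        using q by (auto simp: in_set_conv_nth)
      have "n \<in> range idx" using n(1) gp(2) idx by (simp add: bij_betw_def)
      then obtain j where "n = idx j" ..
      then show ?thesis
        using i(1)[of j] n(2) by (simp add: eval3_form_eq_translate3[OF F])
    qed
    ultimately show False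
      using mult_at_ge_2D[OF i(2)] by auto
  qed
  moreover have "card {i. eval3 F (?Q i) = 0} < 3" if "is_form 1 F" for F
    by (rule bound[OF that]) (use gp(1) in \<open>simp add: in_general_position_def\<close>)
  moreover have "card {i. eval3 F (?Q i) = 0} < 6" if "is_form 2 F" for F
    by (rule bound[OF that]) (use gp(1) in \<open>simp add: in_general_position_def\<close>)
  ultimately show ?thesis
    unfolding general_position_def by blast
qed

section \<open>Multiplicities and irreducibility\<close>

definition has_mult :: "int \<Rightarrow> nat \<Rightarrow> int list \<Rightarrow> int \<times> int \<times> int \<Rightarrow> nat \<Rightarrow> bool" where
  "has_mult p d cs q m \<longleftrightarrow>
     (\<forall>l\<in>set [0..<m]. \<forall>e\<in>set (exponents l). dot cs (map (jet q e) (exponents d)) mod p = 0) \<and>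
     (\<exists>e\<in>set (exponents m). dot cs (map (jet q e) (exponents d)) mod p \<noteq> 0)"

lemma coeff3_translate3_int_form_eq_0_iff:
  "coeff3 (translate3 (int_point q) (form_of d (map of_int cs) :: 'a::field poly3)) a b c = 0 \<longleftrightarrow>
    dot cs (map (jet q (a, b, c)) (exponents d)) mod int CHAR('a) = 0"
  unfolding coeff3_translate3_int_point of_int_dot[symmetric]
  by (simp add: of_int_eq_0_iff_char_dvd dvd_eq_mod_eq_0)

lemma mult_at_int_form:
  assumes "has_mult (int CHAR('a::field)) d cs q m"
  shows "mult_at (form_of d (map of_int cs) :: 'a poly3) (int_point q) = m"
proof -
  obtain a b c where "a + b + c = m"
    "coeff3 (translate3 (int_point q) (form_of d (map of_int cs) :: 'a poly3)) a b c \<noteq> 0"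
    using assms by (auto simp: has_mult_def set_exponents coeff3_translate3_int_form_eq_0_iff)
  moreover have "coeff3 (translate3 (int_point q) (form_of d (map of_int cs) :: 'a poly3)) a b c = 0"
    if "a + b + c < m" for a b c
    using assms that by (auto simp: has_mult_def set_exponents coeff3_translate3_int_form_eq_0_iff)
  ultimately show ?thesis
    unfolding mult_at_def by (intro Least_equality) (blast, meson not_le)
qed

section \<open>Irreducibility by restriction to a line\<close>

definition monic_coeffs :: "nat \<Rightarrow> int list \<Rightarrow> bool" where
  "monic_coeffs d cs \<longleftrightarrow> dot cs (map (\<lambda>t. if t = (0, 0, d) then 1 else 0) (exponents d)) = 1"

lemma coeff3_form_of:
  "coeff3 (form_of d cs) i j k =
    dot cs (map (\<lambda>t. if t = (i, j, k) then 1 else 0 :: 'a::semiring_1) (exponents d))"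
proof -
  have "coeff3 (form_of d cs) i j k = (\<Sum>(c, t)\<leftarrow>zip cs (exponents d). coeff3 (mono3 c t) i j k)"
    by (rule additive_form_of) simp_all
  also have "\<dots> = dot cs (map (\<lambda>t. if t = (i, j, k) then 1 else 0) (exponents d))"
    by (auto simp: dot_def zip_map2 intro!: arg_cong[of _ _ sum_list])
  finally show ?thesis .
qed

text \<open>In a form of degree d the coefficient of \<open>z ^ d\<close> is constant in x and y;
  once it is 1, the form is monic in the outer variable.\<close>

lemma monic_form:
  assumes "monic_coeffs d cs"
  defines "F \<equiv> form_of d (map of_int cs) :: 'a::field poly3"
  shows "is_form d F" "degree F = d" "lead_coeff F = 1"
proof -
  have top: "coeff3 F 0 0 d = 1"
  proof -
    have "coeff3 F 0 0 d =
        of_int (dot cs (map (\<lambda>t. if t = (0, 0, d) then 1 else 0) (exponents d)))"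
      unfolding F_def coeff3_form_of of_int_dot by (simp add: comp_def if_distrib cong: if_cong)
    then show ?thesis using assms(1) by (simp add: monic_coeffs_def)
  qed
  have off: "coeff3 F i j k = 0" if "i + j + k \<noteq> d" for i j k
    unfolding F_def using that by (rule coeff3_form_of_eq_0)
  have "F \<noteq> 0" using top by auto
  then show "is_form d F" using off by (auto simp: is_form_def)
  have "coeff F d = 1"
  proof (intro poly_eqI)
    show "coeff (coeff (coeff F d) j) i = coeff (coeff 1 j) i" for i j
      using top off[of i j d] by (auto simp: coeff3_def coeff_1)
  qed
  moreover have "coeff F k = 0" if "k > d" for k
    using off[of _ _ k] that by (intro poly_eqI) (auto simp: coeff3_def)
  ultimately show "degree F = d" 
    by (metis (no_types, lifting) leading_coeff_neq_0 \<open>F \<noteq> 0\<close> le_degree le_antisym not_le zero_neq_one)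
  with \<open>coeff F d = 1\<close> show "lead_coeff F = 1" by simp
qed

text \<open>The restriction to the line x = y, dehomogenised by x = y = 1, with z as the remaining
  variable.\<close>

definition restrict_line :: "'a::comm_semiring_1 poly3 \<Rightarrow> 'a poly" where
  "restrict_line = map_poly (\<lambda>p. poly (poly p 1) 1)"

lemma coeff_restrict_line: "coeff (restrict_line F) k = poly (poly (coeff F k) 1) 1"
  by (simp add: restrict_line_def coeff_map_poly)

lemma restrict_line_mult: "restrict_line (F * G) = restrict_line F * restrict_line G"
  by (intro poly_eqI) (simp add: coeff_restrict_line coeff_mult poly_sum)

text \<open>The leading coefficients in \<open>z\<close> of the factors are units, so the factors keep their degree on
  the line \<open>x = y\<close>.\<close>

lemma irreducible_if_restrict_line:
  fixes F :: "'a::field poly3"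
  assumes F: "lead_coeff F = 1" "degree F > 0"
    and *: "\<And>g h. restrict_line F = g * h \<Longrightarrow> degree g = 0 \<or> degree h = 0"
  shows "irreducible F"
proof (rule irreducibleI)
  show "F \<noteq> 0" using F(2) by auto
  show "\<not> F dvd 1"
    using F(2) poly_dvd_1[of F] by (metis is_unit_poly_iff degree_pCons_0 less_irrefl)
  fix G H assume GH: "F = G * H"
  have deg: "degree (restrict_line G) = degree G" if "lead_coeff G * c = 1" for G :: "'a poly3" and c
  proof -
    have "poly (poly (lead_coeff G) 1) 1 * poly (poly c 1) 1 = 1"
      using arg_cong[OF that, of "\<lambda>p. poly (poly p 1) 1"] by simp
    then have "coeff (restrict_line G) (degree G) \<noteq> 0"
      by (auto simp: coeff_restrict_line)
    then show ?thesis
      by (intro le_antisym le_degree degree_le) (auto simp: coeff_restrict_line coeff_eq_0)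
  qed
  \<comment> \<open>A factor with constant restriction has degree 0 in z, so it equals its own
    leading coefficient, which divides 1.\<close>
  have unit: "G dvd 1" if "lead_coeff G * c = 1" "degree (restrict_line G) = 0" for G :: "'a poly3" and c
  proof -
    have "degree G = 0" using deg[OF that(1)] that(2) by simp
    then obtain a where "G = [:a:]" by (meson degree_eq_zeroE)
    with that(1) show ?thesis by (auto simp: const_poly_dvd_1 intro: dvdI[of _ _ c])
  qed
  have lc: "lead_coeff G * lead_coeff H = 1" "lead_coeff H * lead_coeff G = 1"
    using F(1) by (simp_all add: GH lead_coeff_mult mult.commute)
  have "degree (restrict_line G) = 0 \<or> degree (restrict_line H) = 0"
    by (rule *) (simp add: GH restrict_line_mult)
  then show "G dvd 1 \<or> H dvd 1"
    using unit[OF lc(1)] unit[OF lc(2)] by blast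
qed

lemma degree_SucE:
  assumes "degree p = Suc n"
  obtains a q where "p = pCons a q" "degree q = n"
  using assms by (cases p) (auto split: if_splits)

lemma degree_1_root:
  fixes g :: "'a::field poly"
  assumes "degree g = 1"
  shows "\<exists>r. poly g r = 0"
proof -
  obtain a q where q: "g = pCons a q" "degree q = 0"
    by (rule degree_SucE[of g 0]) (use assms in auto)
  then obtain b where "q = [:b:]" by (auto elim: degree_eq_zeroE)
  with q assms have "poly g (- a / b) = 0" by (auto split: if_splits)
  then show ?thesis ..
qed

text \<open>After scaling, one factor is \<open>z ^ 2 + u * z + v\<close>, and the coefficients c
  and d force the cofactor to have the coefficients \<open>d - u\<close> and
  \<open>c - v - u * (d - u)\<close>. The two lowest coefficients give the equations, so a search
  over the pairs (u, v) decides.\<close>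

lemma quartic_factors:
  fixes f :: "'a::field poly"
  assumes f: "f = [:a, b, c, d, 1:]" "f = g * h" "degree g = 2"
  shows "\<exists>u v. a = v * (c - v - u * (d - u)) \<and> b = u * (c - v - u * (d - u)) + (d - u) * v"
proof -
  have "degree f = 4" by (simp add: f(1))
  then have "degree h = 2"
    using f(2,3) by (metis add_left_imp_eq degree_mult_eq degree_0 mult_eq_0_iff numeral_Bit0 zero_neq_numeral)
  have "\<exists>v u l. p = [:v, u, l:]" if "degree p = 2" for p :: "'a poly"
    using that by (metis degree_SucE degree_eq_zeroE numeral_2_eq_2)
  with f(3) \<open>degree h = 2\<close> obtain v u l v' u' l'
    where gh: "g = [:v, u, l:]" "h = [:v', u', l':]" by metis
  have e: "a = v * v'" "b = u * v' + u' * v" "c = l * v' + u * u' + l' * v" "d = l * u' + l' * u"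
    "1 = l * l'"
    using f(1,2) unfolding gh by (simp_all add: algebra_simps)
  have D: "d - l' * u = l * u'" by (simp add: e(4))
  have "c - l' * v - l' * u * (l * u') = l * v' + (1 - l * l') * (u * u')"
    by (simp add: e(3) algebra_simps)
  then have C: "c - l' * v - l' * u * (l * u') = l * v'" by (simp add: e(5)[symmetric])
  have ab: "a = (l * l') * (v * v')" "b = (l * l') * (u * v') + (l * l') * (u' * v)"
    by (simp_all add: e(1,2) e(5)[symmetric])
  \<comment> \<open>The leading coefficients \<open>l\<close> and \<open>l'\<close> are inverse to
    each other, so multiplication by \<open>l'\<close> makes \<open>g\<close> monic.\<close>
  show ?thesis
    by (rule exI[of _ "l' * u"], rule exI[of _ "l' * v"]) (simp only: D C, simp add: ab mult_ac)
qed

definition line_coeffs :: "nat \<Rightarrow> int list \<Rightarrow> int list" where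
  "line_coeffs d cs =
     map (\<lambda>k. dot cs (map (\<lambda>(i, j, l). if l = k then 1 else 0) (exponents d))) [0..<Suc d]"

lemma restrict_line_simps:
  "restrict_line 0 = 0" "restrict_line (F + G) = restrict_line F + restrict_line G"
  "restrict_line (mono3 c (i, j, k)) = monom c k"
  by (auto intro!: poly_eqI simp: coeff_restrict_line poly_monom)

lemma restrict_line_int_form:
  "restrict_line (form_of d (map of_int cs)) = Poly (map of_int (line_coeffs d cs) :: 'a::comm_ring_1 list)"
proof (rule poly_eqI)
  fix k
  have "coeff (restrict_line (form_of d (map of_int cs))) k =
      (\<Sum>(c, t)\<leftarrow>zip (map of_int cs) (exponents d). coeff (restrict_line (mono3 c t :: 'a poly3)) k)"
    by (rule additive_form_of) (simp_all add: restrict_line_simps)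
  also have "\<dots> = dot (map of_int cs) (map (\<lambda>(i, j, l). if l = k then 1 else 0) (exponents d))"
    unfolding dot_def zip_map2
    by (auto simp: restrict_line_simps simp del: mono3.simps intro!: arg_cong[of _ _ sum_list])
  also have "\<dots> = of_int (dot cs (map (\<lambda>(i, j, l). if l = k then 1 else 0) (exponents d)))"
    by (simp add: of_int_dot comp_def split_def if_distrib cong: if_cong)
  also have "\<dots> = coeff (Poly (map of_int (line_coeffs d cs) :: 'a list)) k"
  proof (cases "k \<le> d")
    case True
    then show ?thesis by (simp add: nth_default_def line_coeffs_def del: upt_Suc)
  next
    case False
    have "dot cs (map (\<lambda>(i, j, l). if l = k then 1 else 0) ts) = 0"
      if "set ts \<subseteq> set (exponents d)" for ts
      using that False
      by (induction cs ts rule: list_induct2') (auto simp: set_exponents)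
    with False show ?thesis by (simp add: nth_default_def line_coeffs_def del: upt_Suc)
  qed
  finally show "coeff (restrict_line (form_of d (map of_int cs))) k =
      coeff (Poly (map of_int (line_coeffs d cs) :: 'a list)) k" .
qed

text \<open>The fold is Horner's scheme for a list that starts with the constant term.\<close>

definition no_root :: "int \<Rightarrow> int list \<Rightarrow> bool" where
  "no_root p f \<longleftrightarrow> (\<forall>r\<in>set [0..p - 1]. foldr (\<lambda>c s. c + r * s) f 0 mod p \<noteq> 0)"

text \<open>Here \<open>w\<close> and \<open>x\<close> are the coefficients of the cofactor forced
  as in \<open>quartic_factors\<close>.\<close>

definition no_quadratic_factor :: "int \<Rightarrow> int list \<Rightarrow> bool" where
  "no_quadratic_factor p f \<longleftrightarrow> (\<forall>u\<in>set [0..p - 1]. \<forall>v\<in>set [0..p - 1].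
     let w = f ! 3 - u; x = f ! 2 - v - u * w in
     (f ! 0 - v * x) mod p \<noteq> 0 \<or> (f ! 1 - (u * x + w * v)) mod p \<noteq> 0)"

text \<open>A reducible polynomial of degree 3 over a field has a root; one of degree 4 has a root
  or is a product of two quadratics. The ten curves have degrees 1, 3 and 4 only.\<close>

definition certified_irreducible :: "int \<Rightarrow> nat \<Rightarrow> int list \<Rightarrow> bool" where
  "certified_irreducible p d cs \<longleftrightarrow> monic_coeffs d cs \<and> line_coeffs d cs ! d = 1 \<and>
     (d = 1 \<or> (d = 3 \<or> d = 4 \<and> no_quadratic_factor p (line_coeffs d cs)) \<and>
       no_root p (line_coeffs d cs))"

lemma mod_ring_eq_of_int:
  fixes x :: "'a::prime_card mod_ring"
  obtains r where "r \<in> set [0..int CARD('a) - 1]" "x = of_int r"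
proof -
  obtain n where "n < CARD('a)" "x = of_nat n" using surj_of_nat_mod_ring[of x] by auto
  then show thesis by (intro that[of "int n"]) auto
qed

lemma poly_Poly_of_int:
  "poly (Poly (map of_int f)) (of_int r :: 'a::comm_ring_1) = of_int (foldr (\<lambda>c s. c + r * s) f 0)"
  by (induction f) auto

lemma irreducible_int_form:
  assumes "certified_irreducible (int CARD('a)) d cs"
  shows "irreducible (form_of d (map of_int cs) :: 'a::prime_card mod_ring poly3)"
proof (rule irreducible_if_restrict_line)
  let ?F = "form_of d (map of_int cs) :: 'a mod_ring poly3"
  have monic: "monic_coeffs d cs" and d: "d = 1 \<or> d = 3 \<or> d = 4"
    using assms by (auto simp: certified_irreducible_def)
  show "lead_coeff ?F = 1" "degree ?F > 0"
    using monic_form[OF monic, where 'a = "'a mod_ring"] d by auto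
  let ?f = "line_coeffs d cs"
  fix g h assume gh: "restrict_line ?F = g * h"
  have len: "length ?f = Suc d" by (simp add: line_coeffs_def)
  have top: "?f ! d = 1" using assms by (auto simp: certified_irreducible_def)
  have mod0: "(of_int n = (0 :: 'a mod_ring)) = (n mod int CARD('a) = 0)" for n
    by (simp add: of_int_eq_0_iff_char_dvd dvd_eq_mod_eq_0)
  have rl: "restrict_line ?F = Poly (map of_int ?f)" by (rule restrict_line_int_form)
  have "coeff (restrict_line ?F) d = 1" "\<And>k. k > d \<Longrightarrow> coeff (restrict_line ?F) k = 0"
    unfolding rl using top len by (simp_all add: nth_default_def)
  then have deg: "degree (restrict_line ?F) = d"
    by (metis le_antisym le_degree degree_le zero_neq_one)
  then have deg_gh: "degree g + degree h = d"
    using gh d by (metis degree_0 degree_mult_eq mult_zero_left mult_zero_right zero_neq_numeral zero_neq_one)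
  have no_deg_1: False if p: "degree p = 1" "p dvd restrict_line ?F" "d \<noteq> 1" for p
  proof -
    obtain r where "poly p r = 0" using degree_1_root[OF p(1)] ..
    then have "poly (restrict_line ?F) r = 0" using p(2) by auto
    moreover obtain n where "n \<in> set [0..int CARD('a) - 1]" "r = of_int n"
      by (rule mod_ring_eq_of_int)
    ultimately show False
      using assms p(3) unfolding rl
      by (auto simp: poly_Poly_of_int mod0 certified_irreducible_def no_root_def)
  qed
  show "degree g = 0 \<or> degree h = 0"
  proof (rule ccontr)
    assume pos: "\<not> ?thesis"
    have "degree g \<noteq> 1 \<and> degree h \<noteq> 1 \<or> d = 1"
      using no_deg_1[of g] no_deg_1[of h] gh by auto
    with pos deg_gh d have "degree g = 2" "d = 4" by auto
    obtain a b c e where f: "?f = [a, b, c, e, 1]"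
      using len top unfolding \<open>d = 4\<close> by (auto simp: length_Suc_conv numeral_eq_Suc)
    have "restrict_line ?F = [:of_int a, of_int b, of_int c, of_int e, 1:]"
      unfolding rl f by simp
    from quartic_factors[OF this gh \<open>degree g = 2\<close>] obtain u v :: "'a mod_ring" where
      uv: "of_int a = v * (of_int c - v - u * (of_int e - u))"
      "of_int b = u * (of_int c - v - u * (of_int e - u)) + (of_int e - u) * v" by blast
    obtain u' v' where r: "u' \<in> set [0..int CARD('a) - 1]" "u = of_int u'"
      "v' \<in> set [0..int CARD('a) - 1]" "v = of_int v'"
      using mod_ring_eq_of_int[of u] mod_ring_eq_of_int[of v] by metis
    have "of_int (a - v' * (c - v' - u' * (e - u'))) = (0 :: 'a mod_ring)"
      "of_int (b - (u' * (c - v' - u' * (e - u')) + (e - u') * v')) = (0 :: 'a mod_ring)"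
      using uv unfolding r(2,4) by simp_all
    moreover have "no_quadratic_factor (int CARD('a)) [a, b, c, e, 1]"
      using assms f \<open>d = 4\<close> by (simp add: certified_irreducible_def)
    ultimately show False
      using r(1,3) unfolding mod0 by (force simp: no_quadratic_factor_def Let_def)
  qed
qed

section \<open>The Picard lattice\<close>

declare mono3.simps [simp del]

text \<open>The line z = 0 represents the class H of a line. It avoids the eight points, whose third
  coordinate will be 1.\<close>

definition z_form :: "'a::comm_semiring_1 poly3" where
  "z_form = mono3 1 (0, 0, 1)"

lemma z_form_power: "z_form ^ d = mono3 1 (0, 0, d)"
  by (simp add: z_form_def mono3.simps monom_power)

lemma is_form_z_power: "is_form d (mono3 1 (0, 0, d) :: 'a::field poly3)"
  by (auto simp: is_form_def split: if_splits) (simp add: mono3.simps monom_eq_0_iff)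

lemma mult_at_z_power:
  assumes "q $ 3 \<noteq> 0"
  shows "mult_at (mono3 1 (0, 0, d) :: 'a::field poly3) q = 0"
  unfolding mult_at_def
  by (rule Least_eq_0) (use assms in \<open>auto simp: coeff3_translate3_mono3 intro!: exI[of _ 0]\<close>)

lemma irreducible_curve_z: "irreducible_curve (Strict (z_form :: 'a::field poly3))"
proof -
  have lc: "lead_coeff (z_form :: 'a poly3) = 1" "degree (z_form :: 'a poly3) = 1"
    by (simp_all add: z_form_def mono3.simps degree_monom_eq)
  have "irreducible (z_form :: 'a poly3)"
  proof (rule irreducible_if_restrict_line)
    fix g h :: "'a poly"
    assume "restrict_line z_form = g * h"
    then have gh: "g * h = monom 1 1" by (simp only: z_form_def restrict_line_simps)
    then have "g \<noteq> 0" "h \<noteq> 0" by auto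
    then have "degree g + degree h = 1"
      using gh by (metis degree_mult_eq degree_monom_eq zero_neq_one)
    then show "degree g = 0 \<or> degree h = 0" by auto
  qed (use lc in auto)
  with lc show ?thesis
    using is_form_z_power[of 1, where 'a = 'a] by (auto simp: z_form_def)
qed

text \<open>The quotient of the two irreducible polynomials is a unit, hence a constant, and the
  normalised leading coefficients make it 1.\<close>

lemma irreducible_curve_eqI:
  fixes G H :: "'a::field_gcd poly3"
  assumes "irreducible_curve (Strict G)" "irreducible_curve (Strict H)" "H dvd G"
  shows "H = G"
proof -
  obtain K where K: "G = H * K" using assms(3) by (rule dvdE)
  have "irreducible G" "\<not> is_unit H" using assms(1,2) by auto
  then have "is_unit K" using K irreducibleD by blast
  then obtain k where k: "K = [:[:[:k:]:]:]"
    by (auto simp: is_unit_poly_iff elim: degree_eq_zeroE)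
  have "lead_coeff (lead_coeff (lead_coeff G)) = lead_coeff (lead_coeff (lead_coeff H)) * k"
    by (simp add: K k lead_coeff_mult)
  with assms(1,2) have "k = 1" by simp
  then show ?thesis by (simp add: K k flip: one_pCons)
qed

text \<open>Irreducible polynomials are prime here, so \<open>H\<close> can divide a power of
  \<open>G\<close> only if it divides \<open>G\<close> and hence equals it.\<close>

lemma multiplicity_irreducible_curve:
  fixes G H :: "'a::field_gcd poly3"
  assumes "irreducible_curve (Strict G)" "irreducible_curve (Strict H)"
  shows "multiplicity H (G ^ n) = (if H = G then n else 0)"
proof (cases "H = G")
  case True
  have "G \<noteq> 0" "\<not> is_unit G" using assms(1) by auto
  then show ?thesis using True by (simp add: multiplicity_same_power)
next
  case False
  then have "\<not> H dvd G" using irreducible_curve_eqI[OF assms] by blast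
  moreover have "prime_elem H"
    using assms(2) by (intro irreducible_imp_prime_elem_gcd) auto
  ultimately have "\<not> H dvd G ^ n" using prime_elem_dvd_power by blast
  then show ?thesis using False by (simp add: not_dvd_imp_multiplicity_0)
qed

section \<open>Divisors of forms and their classes\<close>

lemma divisors_simps [simp]:
  "0 \<in> divisors"
  "D \<in> divisors \<Longrightarrow> E \<in> divisors \<Longrightarrow> D + E \<in> divisors"
  "D \<in> divisors \<Longrightarrow> E \<in> divisors \<Longrightarrow> D - E \<in> divisors"
  "D \<in> divisors \<Longrightarrow> frag_cmul n D \<in> divisors"
  "frag_of C \<in> divisors \<longleftrightarrow> irreducible_curve C"
  using keys_add[of D E] keys_diff[of D E] keys_cmul[of n D]
  by (auto simp: divisors_def keys_frag_of)

lemma divisors_sum [simp]: "(\<And>i. i \<in> A \<Longrightarrow> f i \<in> divisors) \<Longrightarrow> sum f A \<in> divisors"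
  by (induction A rule: infinite_finite_induct) auto

text \<open>The pullback of a plane curve is its strict transform plus each
  \<open>Exceptional i\<close> as often as the multiplicity at \<open>P i\<close>. The exponent
  covers an arbitrary curve (n = 1) as well as \<open>z ^ d\<close>.\<close>

lemma is_div_of_irreducible_power:
  fixes P :: "8 \<Rightarrow> 'a::field_gcd ^ 3"
  assumes "irreducible_curve (Strict G)"
  shows "is_div_of_form P (G ^ n) (frag_cmul (int n) (frag_of (Strict G)) +
    (\<Sum>i\<in>UNIV. frag_cmul (int (mult_at (G ^ n) (P i))) (frag_of (Exceptional i))))"
  unfolding is_div_of_form_def
proof (intro conjI allI impI)
  fix C :: "'a curve"
  assume C: "irreducible_curve C"
  show "Poly_Mapping.lookup (frag_cmul (int n) (frag_of (Strict G)) +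
    (\<Sum>i\<in>UNIV. frag_cmul (int (mult_at (G ^ n) (P i))) (frag_of (Exceptional i)))) C
    = int (ord_along P C (G ^ n))"
  proof (cases C)
    case (Exceptional j)
    have "(\<Sum>i\<in>UNIV. int (mult_at (G ^ n) (P i)) * (if C = Exceptional i then 1 else 0)) =
      (\<Sum>i\<in>UNIV. if j = i then int (mult_at (G ^ n) (P i)) else 0)"
      by (intro sum.cong) (auto simp: Exceptional)
    then show ?thesis by (simp add: lookup_add lookup_sum Exceptional)
  next
    case (Strict H)
    then show ?thesis
      using C multiplicity_irreducible_curve[OF assms, of H n]
      by (simp add: lookup_add lookup_sum)
  qed
qed (use assms in simp)

text \<open>The class d H - m1 E1 - ... - m8 E8 in the Picard group.\<close>

definition curve_class :: "int \<Rightarrow> (8 \<Rightarrow> int) \<Rightarrow> 'a::field_gcd divisor" where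
  "curve_class d m =
     frag_cmul d (frag_of (Strict z_form)) - (\<Sum>i\<in>UNIV. frag_cmul (m i) (frag_of (Exceptional i)))"

lemma curve_class_in_divisors [simp]: "curve_class d m \<in> divisors"
  using irreducible_curve_z unfolding curve_class_def by (intro divisors_simps divisors_sum) auto

lemma is_div_of_z_power:
  fixes P :: "8 \<Rightarrow> 'a::field_gcd ^ 3"
  assumes "\<And>i. P i $ 3 \<noteq> 0"
  shows "is_div_of_form P (mono3 1 (0, 0, d)) (frag_cmul (int d) (frag_of (Strict z_form)))"
  using is_div_of_irreducible_power[OF irreducible_curve_z, of P d]
  unfolding z_form_power mult_at_z_power[OF assms] by simp

text \<open>The rational function F / \<open>z ^ d\<close> realizes the equivalence; its denominator
  vanishes at none of the eight points.\<close>

lemma linearly_equivalent_curve_class: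
  fixes P :: "8 \<Rightarrow> 'a::field_gcd ^ 3"
  assumes "\<And>i. P i $ 3 \<noteq> 0" "irreducible_curve (Strict F)" "is_form d F"
  shows "linearly_equivalent P (frag_of (Strict F)) (curve_class (int d) (\<lambda>i. int (mult_at F (P i))))"
proof -
  have "frag_of (Strict F) - curve_class (int d) (\<lambda>i. int (mult_at F (P i))) =
    (frag_of (Strict F) + (\<Sum>i\<in>UNIV. frag_cmul (int (mult_at F (P i))) (frag_of (Exceptional i)))) -
    frag_cmul (int d) (frag_of (Strict z_form))"
    by (simp add: curve_class_def)
  moreover have "is_div_of_form P F
    (frag_of (Strict F) + (\<Sum>i\<in>UNIV. frag_cmul (int (mult_at F (P i))) (frag_of (Exceptional i))))"
    using is_div_of_irreducible_power[OF assms(2), of P 1] by simp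
  moreover have "is_div_of_form P (mono3 1 (0, 0, d)) (frag_cmul (int d) (frag_of (Strict z_form)))"
    by (rule is_div_of_z_power) (rule assms(1))
  ultimately show ?thesis
    unfolding linearly_equivalent_def using assms(3) is_form_z_power by blast
qed

text \<open>The choice of \<open>z ^ 3\<close> as the cubic form gives the familiar K = -3 H + E1 +
  ... + E8.\<close>

lemma canonical_divisor_curve_class:
  fixes P :: "8 \<Rightarrow> 'a::field_gcd ^ 3"
  assumes "\<And>i. P i $ 3 \<noteq> 0"
  shows "canonical_divisor P (curve_class (- 3) (\<lambda>_. - 1))"
proof -
  have "curve_class (- 3) (\<lambda>_. - 1) = (\<Sum>i\<in>UNIV. frag_of (Exceptional i)) -
      (frag_cmul (int 3) (frag_of (Strict z_form)) :: 'a divisor)"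
    by (simp add: curve_class_def sum_negf flip: minus_frag_cmul)
  moreover have "is_div_of_form P (mono3 1 (0, 0, 3)) (frag_cmul (int 3) (frag_of (Strict z_form)))"
    by (rule is_div_of_z_power) (rule assms)
  ultimately show ?thesis
    unfolding canonical_divisor_def using is_form_z_power[of 3] by blast
qed

section \<open>Consequences of the axioms of the intersection pairing\<close>

locale blowup_pairing =
  fixes P :: "8 \<Rightarrow> 'a::field_gcd ^ 3" and I :: "'a divisor \<Rightarrow> 'a divisor \<Rightarrow> int"
  assumes pairing: "intersection_pairing P I"
begin

lemma pairing_commute: "D \<in> divisors \<Longrightarrow> E \<in> divisors \<Longrightarrow> I D E = I E D"
  using pairing unfolding intersection_pairing_def by blast

lemma pairing_add_left:
  "D \<in> divisors \<Longrightarrow> D' \<in> divisors \<Longrightarrow> E \<in> divisors \<Longrightarrow> I (D + D') E = I D E + I D' E"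
  using pairing unfolding intersection_pairing_def by blast

lemma pairing_linearly_equivalent:
  "linearly_equivalent P D D' \<Longrightarrow> D \<in> divisors \<Longrightarrow> D' \<in> divisors \<Longrightarrow> E \<in> divisors \<Longrightarrow> I D E = I D' E"
  using pairing unfolding intersection_pairing_def by blast

lemma pairing_zero_left: "E \<in> divisors \<Longrightarrow> I 0 E = 0"
  using pairing_add_left[of 0 0 E] by simp

lemma pairing_cmul_left:
  assumes "D \<in> divisors" "E \<in> divisors"
  shows "I (frag_cmul c D) E = c * I D E"
proof -
  have nat: "I (frag_cmul (int n) D) E = int n * I D E" for n
    using assms
    by (induction n) (auto simp: frag_cmul_distrib pairing_zero_left pairing_add_left algebra_simps)
  have "I (frag_cmul (- int n) D) E = - int n * I D E" for n
  proof -
    have "0 = I (frag_cmul (int n) D + frag_cmul (- int n) D) E"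
      using assms by (simp add: pairing_zero_left flip: frag_cmul_distrib)
    also have "\<dots> = int n * I D E + I (frag_cmul (- int n) D) E"
      using assms by (simp only: pairing_add_left divisors_simps nat)
    finally show ?thesis by simp
  qed
  with nat show ?thesis by (cases c rule: int_cases2) simp_all
qed

lemma pairing_diff_left:
  assumes "D \<in> divisors" "D' \<in> divisors" "E \<in> divisors"
  shows "I (D - D') E = I D E - I D' E"
  using pairing_add_left[of "D - D'" D' E] assms by simp

lemma pairing_sum_left:
  "(\<And>i. i \<in> A \<Longrightarrow> f i \<in> divisors) \<Longrightarrow> E \<in> divisors \<Longrightarrow> I (sum f A) E = (\<Sum>i\<in>A. I (f i) E)"
  by (induction A rule: infinite_finite_induct) (auto simp: pairing_zero_left pairing_add_left)

lemma pairing_curve_class_left: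
  assumes "E \<in> divisors"
  shows "I (curve_class d m) E =
    d * I (frag_of (Strict z_form)) E - (\<Sum>i\<in>UNIV. m i * I (frag_of (Exceptional i)) E)"
  using assms irreducible_curve_z[where 'a = 'a] unfolding curve_class_def
  by (simp add: pairing_diff_left pairing_cmul_left pairing_sum_left del: irreducible_curve.simps(2))

text \<open>In the basis H, E1, ..., E8 the form is diagonal with entries 1, -1, ..., -1.\<close>

lemma pairing_curve_class:
  assumes H: "I (frag_of (Strict z_form)) (frag_of (Strict z_form)) = 1"
    "\<And>i. I (frag_of (Strict z_form)) (frag_of (Exceptional i)) = 0"
    and E: "\<And>i j. I (frag_of (Exceptional i)) (frag_of (Exceptional j)) = (if i = j then - 1 else 0)"
  shows "I (curve_class d m) (curve_class d' m') = d * d' - (\<Sum>i\<in>UNIV. m i * m' i)"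
proof -
  note z = irreducible_curve_z[where 'a = 'a]
  have "I (frag_of (Exceptional i)) (frag_of (Strict z_form)) = 0" for i
    using z H(2)[of i] by (subst pairing_commute) (simp_all del: irreducible_curve.simps(2))
  then have "I (curve_class d' m') (frag_of (Strict z_form)) = d'"
    using z by (simp add: pairing_curve_class_left H del: irreducible_curve.simps(2))
  then have "I (frag_of (Strict z_form)) (curve_class d' m') = d'"
    using z by (subst pairing_commute) (simp_all del: irreducible_curve.simps(2))
  moreover have "I (frag_of (Exceptional i)) (curve_class d' m') = m' i" for i
  proof -
    have "I (curve_class d' m') (frag_of (Exceptional i)) = - (\<Sum>j\<in>UNIV. if j = i then - m' j else 0)"
      by (simp add: pairing_curve_class_left H E if_distrib cong: if_cong)
    then show ?thesis by (subst pairing_commute) simp_all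
  qed
  ultimately show ?thesis by (simp add: pairing_curve_class_left)
qed

end

section \<open>Lines and exceptional curves on the blow-up\<close>

definition lin :: "'a::comm_semiring_0 ^ 3 \<Rightarrow> 'a ^ 3 \<Rightarrow> 'a" where
  "lin u q = u $ 1 * q $ 1 + u $ 2 * q $ 2 + u $ 3 * q $ 3"

definition line :: "'a::comm_semiring_1 ^ 3 \<Rightarrow> 'a poly3" where
  "line u = [:[:[:0, u $ 1:], [:u $ 2:]:], [:[:u $ 3:]:]:]"

definition extend_scalars :: "'a::field ^ 3 \<Rightarrow> 'a alg_closure ^ 3" where
  "extend_scalars u = (\<chi> i. to_ac (u $ i))"

lemma extend_scalars_nth [simp]: "extend_scalars u $ i = to_ac (u $ i)"
  by (simp add: extend_scalars_def)

lemma geometric_points_eq: "geometric_points P i = extend_scalars (P i)"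
  by (simp add: geometric_points_def extend_scalars_def)

lemma lin_extend_scalars: "lin (extend_scalars u) (extend_scalars q) = to_ac (lin u q)"
  by (simp add: lin_def)

lemma lin_scale: "lin u (c *s q) = c * lin u q"
  by (simp add: lin_def algebra_simps)

lemma lin_add: "lin u (q + r) = lin u q + lin u r"
  by (simp add: lin_def algebra_simps)

lemma lin_zero [simp]: "lin u 0 = 0"
  by (simp add: lin_def)

lemma exponents_1: "exponents 1 = [(0, 0, 1), (0, 1, 0), (1, 0, 0)]"
  by (simp add: exponents_def)

lemma line_eq_form_of: "line u = form_of 1 [u $ 3, u $ 2, u $ 1]"
  unfolding form_of_def exponents_1
  by (simp add: line_def mono3.simps monom_Suc monom_0)

lemma map3_to_ac_line: "map3 to_ac (line u) = line (extend_scalars u)"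
  by (simp add: map3_def line_def Polynomial.map_poly_pCons)

text \<open>The constant Taylor coefficient is \<open>lin u q\<close> and the linear ones are the
  entries of \<open>u\<close>, not all zero, so the order is at most 1.\<close>

lemma mult_at_line:
  fixes u :: "'a::field ^ 3"
  assumes "u \<noteq> 0"
  shows "mult_at (line u) q = (if lin u q = 0 then 1 else 0)"
proof -
  have c: "coeff3 (translate3 q (line u)) 0 0 0 = lin u q"
    "coeff3 (translate3 q (line u)) 1 0 0 = u $ 1"
    "coeff3 (translate3 q (line u)) 0 1 0 = u $ 2"
    "coeff3 (translate3 q (line u)) 0 0 1 = u $ 3"
    unfolding line_eq_form_of coeff3_translate3_form_of exponents_1
    by (simp_all add: lin_def algebra_simps)
  obtain k where "u $ k \<noteq> 0" using assms by (metis vec_eq_iff zero_index)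
  moreover have "k = 1 \<or> k = 2 \<or> k = 3" by (rule exhaust_3)
  ultimately have "\<exists>i j k. i + j + k = (1 :: nat) \<and> coeff3 (translate3 q (line u)) i j k \<noteq> 0"
    using c(2-4) by (metis add_0 add_0_right)
  then show ?thesis
    unfolding mult_at_def using c(1) by (intro Least_equality) (auto intro!: Suc_leI gr0I)
qed

lemma total_transform_line:
  "total_transform Q (q, v, w) (line u) =
    (if is_centre Q q then [:[:lin u q:], [:lin u v, lin u w:]:] else [:[:lin u q, lin u w:], [:lin u v:]:])"
  by (simp add: total_transform_def line_def map3_def Polynomial.map_poly_pCons eval3_def chart_def
      coord_s_def coord_t_def lin_def algebra_simps)

text \<open>Over a centre on the line the total transform is s times a polynomial in t, and division
  by s leaves a condition on the direction. Over a centre off the line the multiplicity is 0 and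
  nothing is removed.\<close>

lemma local_equation_line:
  fixes u :: "'a::field ^ 3"
  assumes "u \<noteq> 0"
  shows "local_equation Q (q, v, w) (Strict (line u)) =
    (if \<not> is_centre Q q then [:[:lin u q, lin u w:], [:lin u v:]:]
     else if lin u q = 0 then [:[:lin u v, lin u w:]:]
     else [:[:lin u q:], [:lin u v, lin u w:]:])"
proof -
  have "[:0, f:] div coord_s = [:f:]" for f :: "'a poly"
    using nonzero_mult_div_cancel_left[of coord_s "[:f:]"] by (simp add: coord_s_def)
  then show ?thesis
    by (simp add: total_transform_line mult_at_line[OF assms])
qed

lemma irreducible_curve_line:
  fixes u :: "'a::field ^ 3"
  assumes "u $ 3 = 1"
  shows "irreducible_curve (Strict (line u))" "is_form 1 (line u)"
proof -
  have lc: "degree (line u) = 1" "lead_coeff (line u) = 1"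
    using assms by (simp_all add: line_def flip: one_pCons)
  have "coeff3 (line u) i j k = 0" if "i + j + k \<noteq> 1" for i j k
    unfolding line_eq_form_of using that by (rule coeff3_form_of_eq_0)
  with lc(1) show form: "is_form 1 (line u)" by (auto simp: is_form_def)
  have "irreducible (line u)"
  proof (rule irreducible_if_restrict_line)
    fix g h :: "'a poly"
    assume gh: "restrict_line (line u) = g * h"
    have "degree (restrict_line (line u)) = 1"
      using assms by (simp add: restrict_line_def line_def Polynomial.map_poly_pCons)
    then have "degree g + degree h = 1"
      unfolding gh by (metis degree_0 degree_mult_eq mult_zero_left mult_zero_right zero_neq_one)
    then show "degree g = 0 \<or> degree h = 0" by auto
  qed (use lc in auto)
  with form lc show "irreducible_curve (Strict (line u))" by auto
qed

lemma det_vector_3: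
  "det (vector [q, v, w] :: 'a::comm_ring_1 ^ 3 ^ 3) =
    q $ 1 * (v $ 2 * w $ 3 - v $ 3 * w $ 2) - q $ 2 * (v $ 1 * w $ 3 - v $ 3 * w $ 1) +
    q $ 3 * (v $ 1 * w $ 2 - v $ 2 * w $ 1)"
  by (simp add: det_3 algebra_simps)

lemma vec_eq_3_iff: "q = r \<longleftrightarrow> q $ 1 = r $ 1 \<and> q $ 2 = r $ 2 \<and> q $ 3 = (r :: 'a ^ 3) $ 3"
  by (simp add: vec_eq_iff forall_3)

section \<open>Subspaces as points and lines of the projective plane\<close>

lemma span_scale:
  assumes "(c :: 'a::field) \<noteq> 0"
  shows "vec.span {c *s q} = vec.span {q}"
proof -
  have "q = inverse c *s (c *s q)" using assms by simp
  then have "q \<in> vec.span {c *s q}" unfolding vec.span_singleton by blast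
  then show ?thesis by (simp add: vec.span_eq vec.span_base vec.span_scale)
qed

lemma independent_pair:
  fixes q r :: "'a::field ^ 3"
  assumes "q \<noteq> 0" "\<And>c. r \<noteq> c *s q"
  shows "vec.dim (vec.span {q, r}) = 2"
proof -
  have "r \<notin> vec.span {q}" using assms(2) by (auto simp: vec.span_singleton)
  then have "vec.independent (insert r {q})" using assms(1)
    by (intro vec.independent_insertI vec.independent_empty) auto
  moreover have "r \<noteq> q" using assms(2)[of 1] by simp
  ultimately show ?thesis
    by (subst vec.dim_span_eq_card_independent) (auto simp: insert_commute)
qed

text \<open>This fixes the component \<open>l i\<close> of a point of the blow-up wherever its image
  in the plane differs from \<open>Q i\<close>.\<close>

lemma plane_eq_span:
  fixes q r :: "'a::field ^ 3"
  assumes "vec.subspace L" "vec.dim L = 2" "q \<in> L" "r \<in> L" "q \<noteq> 0" "\<And>c. r \<noteq> c *s q"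
  shows "L = vec.span {q, r}"
proof -
  have "vec.span {q, r} \<subseteq> L" using assms by (intro vec.span_minimal) auto
  then show ?thesis
    using assms(1,2) independent_pair[OF assms(5,6)]
    by (metis vec.subspace_dim_equal vec.subspace_span order_refl)
qed

text \<open>The kernel of a nonzero functional has dimension at most 2, as otherwise the functional
  would vanish on all coordinate vectors.\<close>

lemma plane_eq_kernel:
  fixes u :: "'a::field ^ 3"
  assumes "vec.subspace L" "vec.dim L = 2" "L \<subseteq> {r. lin u r = 0}" "u \<noteq> 0"
  shows "L = {r. lin u r = 0}"
proof -
  let ?N = "{r. lin u r = 0}"
  have N: "vec.subspace ?N"
    by (simp add: vec.subspace_def lin_add lin_scale)
  have "vec.dim ?N \<le> 2"
  proof (rule ccontr)
    assume "\<not> vec.dim ?N \<le> 2"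
    then have "?N = UNIV"
      using N by (intro vec.subspace_dim_equal) (auto simp: vec_dim_card simp del: vec.dim_UNIV)
    then have k: "lin u (axis k 1) = 0" for k by auto
    have "u = 0"
      using k[of 1] k[of 2] k[of 3] by (simp add: vec_eq_3_iff lin_def axis_def)
    then show False using assms(4) by simp
  qed
  then show ?thesis
    using assms N by (intro vec.subspace_dim_equal) auto
qed

section \<open>Points of the blow-up and of its curves\<close>

locale eight_points =
  fixes P :: "8 \<Rightarrow> 'a::field ^ 3"
  assumes third: "P i $ 3 = 1" and inj: "inj P"
begin

abbreviation "Q \<equiv> geometric_points P"

lemma Q_third [simp]: "Q i $ 3 = 1"
  by (simp add: geometric_points_eq third)

text \<open>The third coordinates are all 1, so proportional coordinate vectors are equal.\<close>

lemma Q_scale: "Q i = c *s Q j \<Longrightarrow> i = j"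
proof -
  assume *: "Q i = c *s Q j"
  from arg_cong[OF this, of "\<lambda>q. q $ 3"] have "c = 1" by simp
  with * have "extend_scalars (P i) = extend_scalars (P j)" by (simp add: geometric_points_eq)
  then have "P i = P j" by (simp add: vec_eq_iff)
  then show "i = j" using inj by (simp add: inj_eq)
qed

lemma span_Q: "vec.span {Q i} = vec.span {Q j} \<longleftrightarrow> i = j"
proof
  assume "vec.span {Q i} = vec.span {Q j}"
  then have "Q i \<in> vec.span {Q j}" using vec.span_base[of "Q i" "{Q i}"] by simp
  then show "i = j" using Q_scale by (auto simp: vec.span_singleton)
qed simp

lemma Q_nonzero: "Q i \<noteq> 0"
  by (metis Q_third zero_index zero_neq_one)

text \<open>Away from \<open>Q i\<close> the local equation is 1, which has no zero.\<close>

lemma curve_points_Exceptional: "(p, l) \<in> curve_points P (Exceptional i) \<Longrightarrow> p = vec.span {Q i}"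
  by (auto simp: curve_points_def frame_at_def geometric_equation_def split: if_splits)

lemma geometric_equation_line:
  assumes "u \<noteq> 0"
  shows "geometric_equation P (q, v, w) (Strict (line u)) =
    (if \<not> is_centre Q q then [:[:lin (extend_scalars u) q, lin (extend_scalars u) w:], [:lin (extend_scalars u) v:]:]
     else if lin (extend_scalars u) q = 0 then [:[:lin (extend_scalars u) v, lin (extend_scalars u) w:]:]
     else [:[:lin (extend_scalars u) q:], [:lin (extend_scalars u) v, lin (extend_scalars u) w:]:])"
proof -
  have u: "extend_scalars u \<noteq> 0" using assms by (auto simp: vec_eq_iff)
  show ?thesis
    unfolding geometric_equation_def geometric_curve.simps map3_to_ac_line
    by (rule local_equation_line[OF u])
qed

text \<open>Over a centre on the line, the local equation vanishes at the origin just when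
  \<open>v\<close> points along the line; over a centre off the line its value there is
  nonzero.\<close>

lemma curve_points_lineD:
  assumes "(p, l) \<in> curve_points P (Strict (line u))" "u \<noteq> 0"
  obtains q v w where "frame_at Q (p, l) (q, v, w)" "lin (extend_scalars u) q = 0"
    "is_centre Q q \<Longrightarrow> lin (extend_scalars u) v = 0"
proof -
  obtain B where B: "frame_at Q (p, l) B" "coeff (coeff (geometric_equation P B (Strict (line u))) 0) 0 = 0"
    using assms(1) by (auto simp: curve_points_def)
  obtain q v w where qvw: "B = (q, v, w)" by (cases B)
  show thesis
    by (rule that[of q v w])
      (use B in \<open>auto simp: qvw geometric_equation_line[OF assms(2)] split: if_splits\<close>)
qed

lemma frame_atD:
  assumes "frame_at Q (p, l) (q, v, w)"
  shows "p = vec.span {q}" "q \<noteq> 0"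
  using assms by (auto simp: frame_at_def det_vector_3)

lemma not_centre: "(\<And>i c. Q i \<noteq> c *s q) \<Longrightarrow> \<not> is_centre Q q"
proof
  assume *: "\<And>i c. Q i \<noteq> c *s q" "is_centre Q q"
  then obtain i where "vec.span {q} = vec.span {Q i}" by (auto simp: is_centre_def)
  then have "Q i \<in> vec.span {q}" using vec.span_base[of "Q i" "{Q i}"] by simp
  with *(1) show False by (auto simp: vec.span_singleton)
qed

text \<open>The projection to the plane is bijective away from the centres, because each
  \<open>l i\<close> must be the line joining the point to \<open>Q i\<close>.\<close>

lemma blowup_away:
  assumes "q \<noteq> 0" "\<And>i c. Q i \<noteq> c *s q"
  shows "(vec.span {q}, l) \<in> geometric_blowup P \<longleftrightarrow> l = (\<lambda>i. vec.span {q, Q i})"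
proof
  assume l: "(vec.span {q}, l) \<in> geometric_blowup P"
  show "l = (\<lambda>i. vec.span {q, Q i})"
  proof
    fix i
    have "vec.subspace (l i)" "vec.dim (l i) = 2" "Q i \<in> l i" "vec.span {q} \<subseteq> l i"
      using l by (auto simp: geometric_blowup_def blowup_def)
    then show "l i = vec.span {q, Q i}"
      using assms vec.span_base[of q "{q}"] by (intro plane_eq_span) auto
  qed
next
  have "vec.dim (vec.span {q, Q i}) = 2" for i
    using assms by (rule independent_pair)
  moreover have "Q i \<in> vec.span {q, Q i}" "vec.span {q} \<subseteq> vec.span {q, Q i}" for i
    by (simp add: vec.span_base) (rule vec.span_mono, simp)
  moreover assume "l = (\<lambda>i. vec.span {q, Q i})"
  ultimately show "(vec.span {q}, l) \<in> geometric_blowup P"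
    unfolding geometric_blowup_def blowup_def using assms(1) by (auto simp: vec.subspace_span simp del: vec.dim_span)
qed

lemma disjoint_Exceptional:
  "i \<noteq> j \<Longrightarrow> curve_points P (Exceptional i) \<inter> curve_points P (Exceptional j) = {}"
  using curve_points_Exceptional span_Q by fastforce

lemma disjoint_line_Exceptional:
  assumes "lin u (P i) \<noteq> 0"
  shows "curve_points P (Strict (line u)) \<inter> curve_points P (Exceptional i) = {}"
proof -
  have "u \<noteq> 0" using assms by (auto simp: lin_def)
  have False
    if pl: "(p, l) \<in> curve_points P (Strict (line u))" "(p, l) \<in> curve_points P (Exceptional i)" for p l
  proof -
    obtain q v w where q: "frame_at Q (p, l) (q, v, w)" "lin (extend_scalars u) q = 0"
      using curve_points_lineD[OF pl(1) \<open>u \<noteq> 0\<close>] by blast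
    have "vec.span {Q i} = vec.span {q}"
      using curve_points_Exceptional[OF pl(2)] frame_atD(1)[OF q(1)] by simp
    then have "Q i \<in> vec.span {q}" using vec.span_base[of "Q i" "{Q i}"] by simp
    then have "lin (extend_scalars u) (Q i) = 0" using q(2) by (auto simp: vec.span_singleton lin_scale)
    then show False using assms by (simp add: geometric_points_eq lin_extend_scalars)
  qed
  then show ?thesis by auto
qed

lemma frame_at_away:
  assumes "\<And>i c. Q i \<noteq> c *s q" "det (vector [q, v, w] :: 'a alg_closure ^ 3 ^ 3) \<noteq> 0"
  shows "frame_at Q (vec.span {q}, l) (q, v, w)"
  using assms(2) not_centre[OF assms(1)] by (auto simp: frame_at_def is_centre_def)

section \<open>Intersections of lines with each other and with exceptional curves\<close>

abbreviation "line_z \<equiv> line (vector [0, 0, 1] :: 'a ^ 3)"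
abbreviation "line_yz \<equiv> line (vector [0, 1, 1] :: 'a ^ 3)"

text \<open>The lines z = 0 and y + z = 0 meet only at (1, 0, 0), which has third coordinate 0 and
  so is no centre. In the standard basis as frame their equations are t and s + t.\<close>

lemma meet_lines:
  assumes "\<And>i. P i $ 2 + 1 \<noteq> 0"
  shows "meet_transversally P (Strict line_z) (Strict line_yz)"
    "card (curve_points P (Strict line_z) \<inter> curve_points P (Strict line_yz)) = 1"
proof -
  define q v w :: "'a alg_closure ^ 3" where qvw: "q = vector [1, 0, 0]" "v = vector [0, 1, 0]" "w = vector [0, 0, 1]"
  define x where "x = (vec.span {q}, \<lambda>i. vec.span {q, Q i})"
  have nz: "vector [0, 0, 1] \<noteq> (0 :: 'a ^ 3)" "vector [0, 1, 1] \<noteq> (0 :: 'a ^ 3)"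
    by (auto simp: vec_eq_3_iff)
  have away: "Q i \<noteq> c *s q" for i c
    by (auto simp: vec_eq_3_iff qvw)
  have "q \<noteq> 0" by (simp add: vec_eq_3_iff qvw)
  have frame: "frame_at Q x (q, v, w)"
    unfolding x_def by (rule frame_at_away[OF away]) (simp add: det_vector_3 qvw)
  have eqs: "geometric_equation P (q, v, w) (Strict line_z) = [:[:0, 1:], [:0:]:]"
    "geometric_equation P (q, v, w) (Strict line_yz) = [:[:0, 1:], [:1:]:]"
    unfolding geometric_equation_line[OF nz(1)] geometric_equation_line[OF nz(2)]
    using not_centre[OF away] by (simp_all add: qvw lin_def)
  have "x \<in> geometric_blowup P"
    unfolding x_def by (subst blowup_away[OF \<open>q \<noteq> 0\<close> away]) simp
  then have x: "x \<in> curve_points P (Strict line_z)" "x \<in> curve_points P (Strict line_yz)"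
    using frame eqs unfolding curve_points_def by fastforce+
  have unique: "(p, l) = x"
    if pl: "(p, l) \<in> curve_points P (Strict line_z)" "(p, l) \<in> curve_points P (Strict line_yz)" for p l
  proof -
    obtain q1 v1 w1 where q1: "frame_at Q (p, l) (q1, v1, w1)" "lin (extend_scalars (vector [0, 0, 1])) q1 = 0"
      using curve_points_lineD[OF pl(1) nz(1)] by blast
    obtain q2 v2 w2 where q2: "frame_at Q (p, l) (q2, v2, w2)" "lin (extend_scalars (vector [0, 1, 1])) q2 = 0"
      using curve_points_lineD[OF pl(2) nz(2)] by blast
    have "q2 \<in> vec.span {q1}"
      using frame_atD(1)[OF q1(1)] frame_atD(1)[OF q2(1)] vec.span_base[of q2 "{q2}"] by simp
    then obtain c where c: "q2 = c *s q1" by (auto simp: vec.span_singleton)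
    with q1(2) q2(2) have "q2 $ 3 = 0" "q2 $ 2 = 0" by (simp_all add: lin_def)
    then have q2q: "q2 = q2 $ 1 *s q" by (simp add: vec_eq_3_iff qvw)
    moreover from this have "q2 $ 1 \<noteq> 0" using frame_atD(2)[OF q2(1)] by auto
    ultimately have "vec.span {q2} = vec.span {q}" by (metis span_scale)
    then have "p = vec.span {q}" using frame_atD(1)[OF q2(1)] by simp
    moreover have "(p, l) \<in> geometric_blowup P" using pl(1) by (simp add: curve_points_def)
    ultimately show ?thesis
      using blowup_away[OF \<open>q \<noteq> 0\<close> away] by (simp add: x_def)
  qed
  then have only: "curve_points P (Strict line_z) \<inter> curve_points P (Strict line_yz) = {x}"
    using x by auto
  then show "card (curve_points P (Strict line_z) \<inter> curve_points P (Strict line_yz)) = 1" by simp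
  show "meet_transversally P (Strict line_z) (Strict line_yz)"
    unfolding meet_transversally_def only
    by (intro ballI exI[of _ "(q, v, w)"]) (use frame in \<open>auto simp: eqs Let_def\<close>)
qed

text \<open>The only common point is the direction of the line at the centre. In the chosen frame
  the line has the equation t and the exceptional curve the equation s.\<close>

lemma meet_line_Exceptional:
  assumes u: "u $ 3 = 1" "lin u (P i) = 0"
  shows "meet_transversally P (Strict (line u)) (Exceptional i)"
    "card (curve_points P (Strict (line u)) \<inter> curve_points P (Exceptional i)) = 1"
proof -
  let ?u = "extend_scalars u"
  \<comment> \<open>Together with \<open>Q i\<close>, the vector \<open>v\<close> spans the plane
    that represents the line; \<open>w\<close> completes the frame with determinant 1.\<close>
  define v w :: "'a alg_closure ^ 3" where vw: "v = vector [?u $ 2, - ?u $ 1, 0]" "w = vector [0, 0, 1]"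
  define x where "x = (vec.span {Q i}, \<lambda>j. if j = i then vec.span {Q i, v} else vec.span {Q i, Q j})"
  have "u \<noteq> 0" "?u \<noteq> 0" using u(1) by (auto simp: vec_eq_3_iff)
  have lin_Q: "lin ?u (Q i) = 0"
    using u(2) by (simp add: geometric_points_eq lin_extend_scalars)
  then have det: "?u $ 1 * Q i $ 1 + ?u $ 2 * Q i $ 2 = - 1"
    using u(1) by (simp add: lin_def eq_neg_iff_add_eq_0)
  have frame: "frame_at Q x (Q i, v, w)"
    using det by (auto simp: frame_at_def x_def span_Q det_vector_3 vw algebra_simps)
  have lin_v: "lin ?u v = 0" by (simp add: lin_def vw)
  have centre: "is_centre Q (Q i)" by (auto simp: is_centre_def)
  have eqs: "geometric_equation P (Q i, v, w) (Strict (line u)) = [:[:0, 1:]:]"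
    "geometric_equation P (Q i, v, w) (Exceptional i) = [:0, 1:]"
    unfolding geometric_equation_line[OF \<open>u \<noteq> 0\<close>]
    using centre lin_Q lin_v u(1) by (simp_all add: geometric_equation_def coord_s_def) (simp add: lin_def vw)
  have v: "v \<noteq> c *s Q i" for c
  proof
    assume *: "v = c *s Q i"
    from arg_cong[OF this, of "\<lambda>q. q $ 3"] have "c = 0" by (simp add: vw)
    with * det show False by (simp add: vec_eq_3_iff vw)
  qed
  have Qj: "Q j \<noteq> c *s Q i" if "j \<noteq> i" for j c
    using that Q_scale by blast
  have "x \<in> geometric_blowup P"
    unfolding geometric_blowup_def blowup_def x_def
    using Q_nonzero[of i] independent_pair[OF Q_nonzero v] independent_pair[OF Q_nonzero Qj]
    by (auto simp: vec.subspace_span simp del: vec.dim_span intro: vec.span_base subsetD[OF vec.span_mono, rotated])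
  then have x: "x \<in> curve_points P (Strict (line u))" "x \<in> curve_points P (Exceptional i)"
    using frame eqs unfolding curve_points_def by fastforce+
  have unique: "(p, l) = x"
    if pl: "(p, l) \<in> curve_points P (Strict (line u))" "(p, l) \<in> curve_points P (Exceptional i)" for p l
  proof -
    have p: "p = vec.span {Q i}" using curve_points_Exceptional[OF pl(2)] .
    obtain q v' w' where q: "frame_at Q (p, l) (q, v', w')" "lin ?u q = 0"
      "is_centre Q q \<Longrightarrow> lin ?u v' = 0"
      using curve_points_lineD[OF pl(1) \<open>u \<noteq> 0\<close>] by blast
    have "is_centre Q q" using frame_atD(1)[OF q(1)] p by (auto simp: is_centre_def)
    then have v': "lin ?u v' = 0" by (rule q(3))
    have li: "l i = vec.span {q, v'}" using q(1) p by (auto simp: frame_at_def)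
    have bl: "vec.subspace (l j)" "vec.dim (l j) = 2" "Q j \<in> l j" "p \<subseteq> l j" for j
      using pl(1) by (auto simp: curve_points_def geometric_blowup_def blowup_def)
    have N: "vec.subspace {r. lin ?u r = 0}"
      by (simp add: vec.subspace_def lin_add lin_scale)
    have "l i \<subseteq> {r. lin ?u r = 0}"
      unfolding li using q(2) v' by (intro vec.span_minimal N) auto
    then have "l i = {r. lin ?u r = 0}"
      using bl \<open>?u \<noteq> 0\<close> by (intro plane_eq_kernel)
    moreover have "{r. lin ?u r = 0} = vec.span {Q i, v}"
    proof (rule plane_eq_kernel[symmetric])
      show "vec.span {Q i, v} \<subseteq> {r. lin ?u r = 0}"
        using lin_Q lin_v by (intro vec.span_minimal N) auto
    qed (use \<open>?u \<noteq> 0\<close> independent_pair[OF Q_nonzero v] in auto)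
    moreover have "l j = vec.span {Q i, Q j}" if "j \<noteq> i" for j
      using bl[of j] p vec.span_base[of "Q i" "{Q i}"] Q_nonzero Qj[OF that]
      by (intro plane_eq_span) auto
    ultimately show ?thesis by (simp add: x_def p fun_eq_iff)
  qed
  then have only: "curve_points P (Strict (line u)) \<inter> curve_points P (Exceptional i) = {x}"
    using x by auto
  then show "card (curve_points P (Strict (line u)) \<inter> curve_points P (Exceptional i)) = 1" by simp
  show "meet_transversally P (Strict (line u)) (Exceptional i)"
    unfolding meet_transversally_def only
    by (intro ballI exI[of _ "(Q i, v, w)"]) (use frame in \<open>auto simp: eqs Let_def\<close>)
qed

end

text \<open>The chart takes the value q at s = t = 0. Away from the centres this decides which
  curves pass through a point.\<close>

lemma total_transform_origin:
  fixes cs :: "'a::field list"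
  shows "coeff (coeff (total_transform Q B (form_of d cs)) 0) 0 = eval3 (form_of d cs) (fst B)"
proof -
  obtain q v w where B: "B = (q, v, w)" by (cases B)
  define const :: "'a \<Rightarrow> 'a poly poly" where "const = (\<lambda>c. [:[:c:]:])"
  have const: "const 0 = 0" "const (x + y) = const x + const y" for x y
    by (simp_all add: const_def)
  define \<phi> :: "'a poly3 \<Rightarrow> 'a" where "\<phi> F = poly (poly (eval3 (map3 const F) (chart Q B)) 0) 0" for F
  have chart: "poly (poly (chart Q B $ j) 0) 0 = q $ j" for j
    by (simp add: B chart_def coord_s_def coord_t_def)
  have "\<phi> (mono3 c t) = eval3 (mono3 c t) q" for c t
    by (cases t) (simp add: \<phi>_def map3_simps[where h = const, OF const] eval3_mono3 chart, simp add: const_def)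
  moreover have "\<phi> (form_of d cs) = (\<Sum>(c, t)\<leftarrow>zip cs (exponents d). \<phi> (mono3 c t))"
    by (rule additive_form_of) (simp_all add: \<phi>_def map3_simps[where h = const, OF const])
  moreover have "eval3 (form_of d cs) q = (\<Sum>(c, t)\<leftarrow>zip cs (exponents d). eval3 (mono3 c t) q)"
    by (rule additive_form_of) simp_all
  ultimately have "\<phi> (form_of d cs) = eval3 (form_of d cs) q" by simp
  then show ?thesis
    by (simp add: total_transform_def \<phi>_def const_def B poly_0_coeff_0)
qed

section \<open>Intersection numbers of strict transforms\<close>

context blowup_pairing
begin

text \<open>The line y + z = 0 avoids the eight points, so it has class H and its one transversal
  point with z = 0 gives H^2 = 1. The line with coefficients \<open>u i\<close> has class H - E_i
  and meets E_i once, so 1 = (H - E_i) E_i = - E_i^2.\<close>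

lemma pairing_generators:
  assumes "eight_points P" "\<And>i. P i $ 2 + 1 \<noteq> 0"
    and u: "\<And>i. u i $ 3 = 1" "\<And>i j. lin (u i) (P j) = 0 \<longleftrightarrow> j = i"
  shows "I (frag_of (Strict z_form)) (frag_of (Strict z_form)) = 1"
    "I (frag_of (Strict z_form)) (frag_of (Exceptional i)) = 0"
    "I (frag_of (Exceptional i)) (frag_of (Exceptional j)) = (if i = j then - 1 else 0)"
proof -
  interpret eight_points P by fact
  have z: "z_form = line_z"
    by (simp add: z_form_def line_def mono3.simps monom_Suc monom_0)
  have irr: "irreducible_curve (Strict line_z)" "irreducible_curve (Strict line_yz)"
    "irreducible_curve (Strict (line (u i)))" for i
    by (rule irreducible_curve_line(1); simp add: u)+
  have meet: "I (frag_of C) (frag_of D) = int (card (curve_points P C \<inter> curve_points P D))"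
    if "irreducible_curve C" "irreducible_curve D" "meet_transversally P C D" for C D
    using pairing that unfolding intersection_pairing_def by blast
  \<comment> \<open>Curves without a common point meet transversally by vacuity.\<close>
  have disjoint: "I (frag_of C) (frag_of D) = 0"
    if "irreducible_curve C" "irreducible_curve D" "curve_points P C \<inter> curve_points P D = {}" for C D
    using meet[OF that(1,2)] that(3) by (simp add: meet_transversally_def)
  have nonzero: "P i $ 3 \<noteq> 0" for i by (simp add: third)
  have lineq: "I (frag_of (Strict (line v))) D = I (curve_class 1 (\<lambda>i. if lin v (P i) = 0 then 1 else 0)) D"
    if "v $ 3 = 1" "D \<in> divisors" for v D
  proof (rule pairing_linearly_equivalent)
    have "v \<noteq> 0" using that(1) by auto
    show "linearly_equivalent P (frag_of (Strict (line v)))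
        (curve_class 1 (\<lambda>i. if lin v (P i) = 0 then 1 else 0))"
      using linearly_equivalent_curve_class[OF nonzero irreducible_curve_line[OF that(1)]]
      by (simp add: mult_at_line[OF \<open>v \<noteq> 0\<close>] if_distrib cong: if_cong)
  qed (use irreducible_curve_line(1)[OF that(1)] that(2) in \<open>simp_all del: irreducible_curve.simps(2)\<close>)
  have HE: "I (frag_of (Strict z_form)) (frag_of (Exceptional i)) = 0" for i
    unfolding z by (intro disjoint disjoint_line_Exceptional irr) (simp_all add: lin_def third)
  then show "I (frag_of (Strict z_form)) (frag_of (Exceptional i)) = 0" .
  have "lin (vector [0, 1, 1]) (P i) \<noteq> 0" for i
    using assms(2)[of i] by (simp add: lin_def third)
  then have "I (frag_of (Strict line_yz)) (frag_of (Strict line_z)) = I (curve_class 1 (\<lambda>_. 0)) (frag_of (Strict line_z))"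
    using irr(1) by (subst lineq) (simp_all del: irreducible_curve.simps(2))
  moreover have "I (frag_of (Strict line_z)) (frag_of (Strict line_yz)) = 1"
    using meet[OF irr(1,2)] meet_lines[OF assms(2)] by simp
  moreover have "I (frag_of (Strict line_yz)) (frag_of (Strict line_z)) =
      I (frag_of (Strict line_z)) (frag_of (Strict line_yz))"
    using irr by (intro pairing_commute) (simp_all del: irreducible_curve.simps(2))
  ultimately show "I (frag_of (Strict z_form)) (frag_of (Strict z_form)) = 1"
    using irr(1) by (simp add: pairing_curve_class_left z del: irreducible_curve.simps(2))
  show "I (frag_of (Exceptional i)) (frag_of (Exceptional j)) = (if i = j then - 1 else 0)"
  proof (cases "i = j")
    case False
    then show ?thesis using disjoint_Exceptional by (simp add: disjoint)
  next
    case True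
    have E: "I (frag_of (Exceptional k)) (frag_of (Exceptional i)) = 0" if "k \<noteq> i" for k
      using disjoint_Exceptional[OF that] by (simp add: disjoint)
    have "I (frag_of (Strict (line (u i)))) (frag_of (Exceptional i)) = 1"
      using meet_line_Exceptional[OF u(1), of i i] meet[OF irr(3)] u(2) by simp
    then have "I (curve_class 1 (\<lambda>j. if lin (u i) (P j) = 0 then 1 else 0)) (frag_of (Exceptional i)) = 1"
      by (simp add: lineq u(1))
    then have "(\<Sum>k\<in>UNIV. (if k = i then 1 else 0) * I (frag_of (Exceptional k)) (frag_of (Exceptional i))) = - 1"
      by (simp add: pairing_curve_class_left HE u(2))
    then have "(\<Sum>k\<in>UNIV. if k = i then I (frag_of (Exceptional i)) (frag_of (Exceptional i)) else 0) = - 1"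
      by (simp add: if_distrib[of "\<lambda>x. x * _"] cong: if_cong)
    then show ?thesis using True by simp
  qed
qed

text \<open>Each curve is replaced by its class, in the second slot by symmetry of the pairing, and
  the diagonal form then yields the numbers.\<close>

lemma pairing_strict:
  assumes gens: "eight_points P" "\<And>i. P i $ 2 + 1 \<noteq> 0"
      "\<And>i. u i $ 3 = 1" "\<And>i j. lin (u i) (P j) = 0 \<longleftrightarrow> j = i"
    and F: "irreducible_curve (Strict F)" "is_form d F"
  shows "irreducible_curve (Strict G) \<Longrightarrow> is_form d' G \<Longrightarrow>
      I (frag_of (Strict F)) (frag_of (Strict G)) =
        int d * int d' - (\<Sum>i\<in>UNIV. int (mult_at F (P i)) * int (mult_at G (P i)))"
    and "I (frag_of (Strict F)) (curve_class (- 3) (\<lambda>_. - 1)) =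
        (\<Sum>i\<in>UNIV. int (mult_at F (P i))) - 3 * int d"
proof -
  have nonzero: "P i $ 3 \<noteq> 0" for i
    using gens(1) by (simp add: eight_points_def)
  define cl :: "nat \<Rightarrow> 'a poly3 \<Rightarrow> 'a divisor" where
    "cl d F = curve_class (int d) (\<lambda>i. int (mult_at F (P i)))" for d F
  have cl: "I (frag_of (Strict F)) D = I (cl d F) D"
    if "irreducible_curve (Strict F)" "is_form d F" "D \<in> divisors" for F d D
    unfolding cl_def
    using linearly_equivalent_curve_class[of P, OF nonzero that(1,2)] that
    by (intro pairing_linearly_equivalent) (simp_all del: irreducible_curve.simps(2))
  note classes = pairing_curve_class[OF pairing_generators[of u, OF gens]]
  have cl_div: "cl d F \<in> divisors" for d F by (simp add: cl_def)
  show "I (frag_of (Strict F)) (frag_of (Strict G)) =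
      int d * int d' - (\<Sum>i\<in>UNIV. int (mult_at F (P i)) * int (mult_at G (P i)))"
    if G: "irreducible_curve (Strict G)" "is_form d' G"
  proof -
    have div: "frag_of (Strict F) \<in> divisors" "frag_of (Strict G) \<in> divisors"
      using F(1) G(1) by (simp_all del: irreducible_curve.simps(2))
    have "I (frag_of (Strict F)) (frag_of (Strict G)) = I (cl d F) (frag_of (Strict G))"
      by (rule cl[OF F div(2)])
    also have "\<dots> = I (frag_of (Strict G)) (cl d F)"
      by (rule pairing_commute[OF cl_div div(2)])
    also have "\<dots> = I (cl d' G) (cl d F)"
      by (rule cl[OF G cl_div])
    finally show ?thesis
      by (simp add: cl_def classes mult.commute)
  qed
  show "I (frag_of (Strict F)) (curve_class (- 3) (\<lambda>_. - 1)) =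
      (\<Sum>i\<in>UNIV. int (mult_at F (P i))) - 3 * int d"
    by (simp add: cl[OF F] cl_def classes sum_negf)
qed

end

lemma lin_int_point: "lin (int_point (a, b, c)) (int_point (x, y, z)) = (of_int (a * x + b * y + c * z) :: 'a::comm_ring_1)"
  by (simp add: lin_def)

section \<open>The ten curves\<close>

definition points :: "(int \<times> int \<times> int) list" where
  "points = [(1, 9, 1), (5, 4, 1), (18, 13, 1), (15, 17, 1), (6, 13, 1), (17, 2, 1), (0, 1, 1), (17, 3, 1)]"

text \<open>Each entry consists of the degree, the coefficients in the order of \<open>exponents\<close>, and the
  multiplicities at the eight points. All curves pass through \<open>(1, 0, 1)\<close>.\<close>

definition curves :: "(nat \<times> int list \<times> nat list) list" where
  "curves =
    [(3, [1, 9, 15, 13, 7, 4, 17, 14, 14, 16], [2, 0, 1, 1, 1, 1, 1, 1]),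
     (3, [1, 5, 15, 17, 8, 6, 7, 5, 10, 5], [1, 2, 0, 1, 1, 1, 1, 1]),
     (3, [1, 6, 15, 16, 4, 3, 8, 13, 6, 1], [0, 1, 2, 1, 1, 1, 1, 1]),
     (3, [1, 13, 2, 3, 11, 18, 2, 5, 13, 2], [1, 1, 1, 2, 0, 1, 1, 1]),
     (3, [1, 2, 2, 14, 4, 3, 18, 5, 11, 9], [1, 1, 1, 1, 2, 0, 1, 1]),
     (3, [1, 18, 2, 17, 3, 8, 13, 14, 1, 1], [1, 1, 1, 0, 1, 2, 1, 1]),
     (4, [1, 16, 9, 6, 6, 4, 14, 0, 0, 5, 0, 2, 13, 8, 15], [2, 2, 2, 1, 1, 1, 1, 1]),
     (4, [1, 6, 0, 1, 11, 13, 2, 11, 1, 3, 9, 2, 0, 7, 2], [1, 1, 1, 2, 2, 2, 1, 1]),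
     (1, [1, 18, 18], [0, 0, 0, 0, 0, 0, 1, 1]),
     (3, [1, 6, 4, 8, 2, 11, 6, 6, 5, 10], [1, 1, 1, 1, 1, 1, 2, 0])]"

text \<open>Among the eight points, the line with coefficients \<open>lines ! n\<close> contains only \<open>points ! n\<close>.\<close>

definition lines :: "(int \<times> int \<times> int) list" where
  "lines = [(0, 2, 1), (0, 14, 1), (1, 0, 1), (0, 10, 1), (1, 17, 1), (0, 9, 1), (0, 18, 1), (0, 6, 1)]"

section \<open>Verification of the numerical data modulo 19\<close>

lemma curves_certified:
  "\<forall>(d, cs, ms)\<in>set curves. certified_irreducible 19 d cs \<and>
    (\<forall>n\<in>set [0..<8]. has_mult 19 d cs (points ! n) (ms ! n)) \<and> has_mult 19 d cs (1, 0, 1) 1"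
  by code_simp

lemma in_general_position_points: "in_general_position 19 points"
  by code_simp

lemma lines_certified:
  "\<forall>m\<in>set [0..<8]. \<forall>n\<in>set [0..<8]. case (lines ! m, points ! n) of ((a, b, c), (x, y, z)) \<Rightarrow>
     ((a * x + b * y + c * z) mod 19 = 0) = (n = m)"
  by code_simp

text \<open>Nonzero y separates the base points from (1, 0, 1), and nonzero y + 1 keeps them off the
  line y + z = 0.\<close>

lemma points_off_axes:
  "\<forall>(x, y, z)\<in>set points. y mod 19 \<noteq> 0 \<and> (y + 1) mod 19 \<noteq> 0 \<and> z = 1"
  by code_simp

text \<open>The curves are listed such that blocks of three are the triangles and the last entry is
  the isolated vertex; the index divided by 3 names the block.\<close>

lemma intersection_matrix:
  "\<forall>m\<in>set [0..<10]. \<forall>n\<in>set [0..<10]. case (curves ! m, curves ! n) of ((d, _, ms), (d', _, ms')) \<Rightarrow>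
     int d * int d' - (\<Sum>k\<leftarrow>[0..<8]. int (ms ! k) * int (ms' ! k)) =
       (if m = n then - 1 else if m div 3 = n div 3 then 2 else 1)"
  by code_simp

lemma canonical_degrees:
  "\<forall>(d, _, ms)\<in>set curves. (\<Sum>k\<leftarrow>[0..<8]. int (ms ! k)) - 3 * int d = - 1 \<and> length ms = 8"
  by code_simp

text \<open>The multiplicities at the eight points are what tells the ten curves apart.\<close>

lemma distinct_multiplicities: "distinct (map (snd \<circ> snd) curves)"
  by code_simp

text \<open>Only the set of the eight points matters, so any enumeration of the index type serves.\<close>

definition index8 :: "8 \<Rightarrow> nat" where
  "index8 = (SOME f. bij_betw f UNIV {..<8})"

lemma bij_index8: "bij_betw index8 UNIV {..<8}"
proof -
  have "\<exists>f :: 8 \<Rightarrow> nat. bij_betw f UNIV {..<8}"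
    using ex_bij_betw_finite_nat[of "UNIV :: 8 set"] by (simp add: atLeast0LessThan)
  then show ?thesis unfolding index8_def by (rule someI_ex)
qed

lemma index8_less: "index8 i < 8"
  using bij_index8 by (auto simp: bij_betw_def)

lemma sum_index8: "(\<Sum>i\<in>UNIV. f (index8 i)) = (\<Sum>k\<leftarrow>[0..<8]. f k :: int)"
  using sum.reindex_bij_betw[OF bij_index8, of f]
  by (simp add: sum_list_distinct_conv_sum_set atLeast0LessThan del: upt_Suc)

definition base_points :: "8 \<Rightarrow> F19 ^ 3" where
  "base_points i = int_point (points ! index8 i)"

definition curve_form :: "nat \<Rightarrow> F19 poly3" where
  "curve_form n = (case curves ! n of (d, cs, _) \<Rightarrow> form_of d (map of_int cs))"

lemma CHAR_F19: "CHAR(F19) = 19" "CARD(index19) = 19"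
  by (simp_all add: card_index19)

lemma of_int_F19_eq_0_iff: "of_int n = (0 :: F19) \<longleftrightarrow> n mod 19 = 0"
  by (simp add: of_int_eq_0_iff_char_dvd dvd_eq_mod_eq_0 CHAR_F19)

lemma length_points: "length points = 8" and length_curves: "length curves = 10" and length_lines: "length lines = 8"
  by (simp_all add: points_def curves_def lines_def)

lemma geometric_base_points: "geometric_points base_points i = int_point (points ! index8 i)"
  by (cases "points ! index8 i")
    (auto simp: geometric_points_def base_points_def vec_eq_3_iff)

lemma base_points_general_position: "general_position (geometric_points base_points)"
proof -
  have "general_position (\<lambda>i. int_point (points ! index8 i) :: F19 alg_closure ^ 3)"
    by (rule general_position_int_points[OF _ length_points bij_index8])
      (simp add: CHAR_F19 in_general_position_points)
  then show ?thesis by (simp add: geometric_base_points[abs_def])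
qed

lemma curve_form_properties:
  assumes "n < 10" "curves ! n = (d, cs, ms)"
  shows "irreducible_curve (Strict (curve_form n))" "is_form d (curve_form n)"
    "mult_at (curve_form n) (base_points i) = ms ! index8 i"
proof -
  have "(d, cs, ms) \<in> set curves" using assms length_curves by (metis nth_mem)
  then have c: "certified_irreducible 19 d cs" "\<forall>n\<in>set [0..<8]. has_mult 19 d cs (points ! n) (ms ! n)"
    using curves_certified by auto
  have F: "curve_form n = form_of d (map of_int cs)" by (simp add: curve_form_def assms(2))
  have "monic_coeffs d cs" using c(1) by (simp add: certified_irreducible_def)
  note monic = monic_form[OF this, where 'a = F19, folded F]
  from monic(1) show form: "is_form d (curve_form n)" .
  have "irreducible (curve_form n)"
    unfolding F by (rule irreducible_int_form) (use c(1) in \<open>simp add: CHAR_F19\<close>)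
  then show "irreducible_curve (Strict (curve_form n))"
    using form monic(3) by auto
  have "has_mult (int CHAR(F19)) d cs (points ! index8 i) (ms ! index8 i)"
    using c(2) index8_less[of i] unfolding CHAR_F19(1) by simp
  from mult_at_int_form[OF this] show "mult_at (curve_form n) (base_points i) = ms ! index8 i"
    by (simp add: F base_points_def)
qed

lemma inj_curve_form: "inj_on curve_form {..<10}"
proof (rule inj_onI)
  fix m n assume mn: "m \<in> {..<10::nat}" "n \<in> {..<10}" "curve_form m = curve_form n"
  obtain d cs ms d' cs' ms' where c: "curves ! m = (d, cs, ms)" "curves ! n = (d', cs', ms')"
    by (metis prod_cases3)
  have "(d, cs, ms) \<in> set curves" "(d', cs', ms') \<in> set curves"
    using mn c length_curves by (metis lessThan_iff nth_mem)+
  then have len: "length ms = 8" "length ms' = 8" using canonical_degrees by auto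
  have "ms ! k = ms' ! k" if "k < 8" for k
  proof -
    have "k \<in> range index8" using that bij_index8 by (simp add: bij_betw_def)
    then obtain i where "k = index8 i" ..
    then show ?thesis
      using curve_form_properties(3)[OF _ c(1), of i] curve_form_properties(3)[OF _ c(2), of i] mn by simp
  qed
  then have "ms = ms'" using len by (intro nth_equalityI) auto
  then have "map (snd \<circ> snd) curves ! m = map (snd \<circ> snd) curves ! n"
    using mn c length_curves by simp
  then show "m = n"
    using nth_eq_iff_index_eq[OF distinct_multiplicities, of m n] mn length_curves by simp
qed

definition clique :: "nat \<Rightarrow> F19 curve" where
  "clique n = Strict (curve_form n)"

lemma base_points_lines:
  "int_point (lines ! index8 i) $ 3 = (1 :: F19)"
  "lin (int_point (lines ! index8 i)) (base_points j) = 0 \<longleftrightarrow> j = i"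
proof -
  have "lines ! index8 i \<in> set lines" using index8_less[of i] length_lines by simp
  moreover obtain a b c where l: "lines ! index8 i = (a, b, c)" by (cases "lines ! index8 i")
  ultimately have "c = 1" by (auto simp: lines_def)
  then show "int_point (lines ! index8 i) $ 3 = (1 :: F19)" by (simp add: l)
  obtain x y z where p: "points ! index8 j = (x, y, z)" by (cases "points ! index8 j")
  have "(a * x + b * y + c * z) mod 19 = 0 \<longleftrightarrow> index8 j = index8 i"
    using bspec[OF bspec[OF lines_certified, of "index8 i"], of "index8 j"]
      index8_less[of i] index8_less[of j] by (simp add: l p del: upt_Suc)
  also have "\<dots> \<longleftrightarrow> j = i"
    using bij_index8 by (auto simp: bij_betw_def inj_def)
  finally show "lin (int_point (lines ! index8 i)) (base_points j) = 0 \<longleftrightarrow> j = i"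
    unfolding base_points_def l p lin_int_point of_int_F19_eq_0_iff .
qed

lemma base_points_coordinates:
  "base_points i $ 2 \<noteq> 0" "base_points i $ 2 + 1 \<noteq> 0" "base_points i $ 3 = 1"
proof -
  obtain x y z where p: "points ! index8 i = (x, y, z)" by (cases "points ! index8 i")
  have "points ! index8 i \<in> set points" using index8_less length_points by simp
  then have "y mod 19 \<noteq> 0" "(y + 1) mod 19 \<noteq> 0" "z = 1"
    using points_off_axes p by auto
  then have "of_int y \<noteq> (0 :: F19)" "of_int (y + 1) \<noteq> (0 :: F19)" "z = 1"
    by (simp_all only: of_int_F19_eq_0_iff not_False_eq_True)
  then show "base_points i $ 2 \<noteq> 0" "base_points i $ 2 + 1 \<noteq> 0" "base_points i $ 3 = 1"
    by (simp_all add: base_points_def p)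
qed

text \<open>Injectivity comes from the separating lines: the one for \<open>i\<close> contains the
  base point \<open>j\<close> only if \<open>j = i\<close>.\<close>

lemma eight_points_base_points: "eight_points base_points"
proof
  show "base_points i $ 3 = 1" for i by (rule base_points_coordinates)
  show "inj base_points"
  proof (rule injI)
    fix i j assume "base_points i = base_points j"
    moreover have "lin (int_point (lines ! index8 i)) (base_points i) = 0"
      by (rule iffD2[OF base_points_lines(2) refl])
    ultimately have "lin (int_point (lines ! index8 i)) (base_points j) = 0" by (simp only:)
    then show "i = j" by (rule iffD1[OF base_points_lines(2), symmetric])
  qed
qed

text \<open>The point (1, 0, 1) is no centre, so a single point of the blow-up lies over it, and a
  curve passes through that point as soon as its equation vanishes at (1, 0, 1).\<close>

lemma common_point:
  "\<exists>x\<in>geometric_blowup base_points. \<forall>n<10. x \<in> curve_points base_points (clique n)"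
proof -
  interpret eight_points base_points by (rule eight_points_base_points)
  define q :: "F19 alg_closure ^ 3" where "q = int_point (1, 0, 1)"
  define B where
    "B = (q, vector [0, 1, 0] :: F19 alg_closure ^ 3, vector [0, 0, 1] :: F19 alg_closure ^ 3)"
  define x where "x = (vec.span {q}, \<lambda>i. vec.span {q, geometric_points base_points i})"
  have "q \<noteq> 0" by (simp add: q_def vec_eq_3_iff)
  have away: "geometric_points base_points i \<noteq> c *s q" for i c
    using base_points_coordinates(1)[of i] by (auto simp: q_def vec_eq_3_iff geometric_points_eq)
  have frame: "frame_at (geometric_points base_points) x B"
    unfolding x_def B_def by (rule frame_at_away[OF away]) (simp add: det_vector_3 q_def)
  have x: "x \<in> geometric_blowup base_points"
    unfolding x_def by (subst blowup_away[OF \<open>q \<noteq> 0\<close> away]) simp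
  have "x \<in> curve_points base_points (clique n)" if "n < 10" for n
  proof -
    obtain d cs ms where c: "curves ! n = (d, cs, ms)" by (metis prod_cases3)
    then have "(d, cs, ms) \<in> set curves" using that length_curves by (metis nth_mem)
    then have "has_mult (int CHAR(F19 alg_closure)) d cs (1, 0, 1) 1"
      using curves_certified by (auto simp: CHAR_F19)
    then have "coeff3 (translate3 q (form_of d (map of_int cs))) 0 0 0 = 0"
      unfolding q_def coeff3_translate3_int_form_eq_0_iff
      by (simp add: has_mult_def exponents_def)
    then have "eval3 (form_of d (map of_int cs)) q = 0"
      by (simp add: eval3_form_of_eq_translate3)
    \<comment> \<open>Extension of scalars preserves the integer coefficients, so the certificate
      modulo 19 applies over the closure.\<close>
    moreover have "map3 to_ac (curve_form n) = form_of d (map of_int cs)"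
      by (simp add: curve_form_def c map3_form_of comp_def)
    ultimately have "coeff (coeff (geometric_equation base_points B (clique n)) 0) 0 = 0"
      using not_centre[OF away]
      by (simp add: geometric_equation_def clique_def B_def total_transform_origin)
    then show ?thesis using x frame by (auto simp: curve_points_def simp del: split_paired_Ex)
  qed
  with x show ?thesis by blast
qed

text \<open>Degrees and multiplicities determine all numbers. The diagonal of the matrix supplies
  the self-intersection -1 that an exceptional curve must have.\<close>

lemma clique_intersections:
  assumes "intersection_pairing base_points I" "m < 10" "n < 10"
  shows "I (frag_of (clique m)) (frag_of (clique n)) =
      (if m = n then - 1 else if m div 3 = n div 3 then 2 else 1)"
    "exceptional_curve base_points I (clique n)"
proof -
  interpret blowup_pairing base_points I by unfold_locales fact
  note pairing' = pairing_strict[OF eight_points_base_points base_points_coordinates(2) base_points_lines]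
  have int: "I (frag_of (clique m)) (frag_of (clique n)) =
      (if m = n then - 1 else if m div 3 = n div 3 then 2 else 1)" if mn: "m < 10" "n < 10" for m n
  proof -
    obtain d cs ms d' cs' ms' where c: "curves ! m = (d, cs, ms)" "curves ! n = (d', cs', ms')"
      by (metis prod_cases3)
    note F = curve_form_properties[OF mn(1) c(1)] and G = curve_form_properties[OF mn(2) c(2)]
    have "I (frag_of (clique m)) (frag_of (clique n)) =
        int d * int d' - (\<Sum>i\<in>UNIV. int (ms ! index8 i) * int (ms' ! index8 i))"
      unfolding clique_def pairing'(1)[OF F(1,2) G(1,2)] F(3) G(3) ..
    also have "\<dots> = int d * int d' - (\<Sum>k\<leftarrow>[0..<8]. int (ms ! k) * int (ms' ! k))"
      by (simp only: sum_index8[of "\<lambda>k. int (ms ! k) * int (ms' ! k)"])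
    also have "\<dots> = (if m = n then - 1 else if m div 3 = n div 3 then 2 else 1)"
      using bspec[OF bspec[OF intersection_matrix, of m], of n] mn by (simp add: c del: upt_Suc)
    finally show ?thesis .
  qed
  show "I (frag_of (clique m)) (frag_of (clique n)) =
      (if m = n then - 1 else if m div 3 = n div 3 then 2 else 1)"
    using int assms by blast
  obtain d cs ms where c: "curves ! n = (d, cs, ms)" by (metis prod_cases3)
  note F = curve_form_properties[OF assms(3) c]
  have "(d, cs, ms) \<in> set curves" using c assms(3) length_curves by (metis nth_mem)
  then have deg: "(\<Sum>k\<leftarrow>[0..<8]. int (ms ! k)) - 3 * int d = - 1"
    using canonical_degrees by auto
  have "I (frag_of (clique n)) (curve_class (- 3) (\<lambda>_. - 1)) =
      (\<Sum>i\<in>UNIV. int (ms ! index8 i)) - 3 * int d"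
    unfolding clique_def pairing'(2)[OF F(1,2)] F(3) ..
  also have "\<dots> = - 1"
    unfolding sum_index8[of "\<lambda>k. int (ms ! k)"] by (rule deg)
  finally have "I (frag_of (clique n)) (curve_class (- 3) (\<lambda>_. - 1)) = - 1" .
  moreover have "canonical_divisor base_points (curve_class (- 3) (\<lambda>_. - 1))"
    by (rule canonical_divisor_curve_class) (simp add: base_points_coordinates)
  moreover have "irreducible_curve (clique n)" unfolding clique_def by (rule F(1))
  ultimately show "exceptional_curve base_points I (clique n)"
    using int[OF assms(3) assms(3)] unfolding exceptional_curve_def by auto
qed

theorem theorem6p7:
  shows "\<exists>P :: 8 \<Rightarrow> F19 ^ 3.
    general_position (geometric_points P) \<and>
    (\<exists>S :: F19 curve set.
       card S = 10 \<and>
       (\<forall>C\<in>S. irreducible_curve C) \<and>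
       (\<exists>x\<in>geometric_blowup P. \<forall>C\<in>S. x \<in> curve_points P C) \<and>
       (\<forall>I. intersection_pairing P I \<longrightarrow>
          (\<forall>C\<in>S. exceptional_curve P I C) \<and>
          (\<forall>C\<in>S. \<forall>D\<in>S. C \<noteq> D \<longrightarrow> I (frag_of C) (frag_of D) \<in> {1, 2}) \<and>
          three_triangles_and_isolated_vertex S (\<lambda>C D. I (frag_of C) (frag_of D) = 2)))"
proof (intro exI[of _ base_points] exI[of _ "clique ` {..<10}"] conjI allI impI)
  have inj: "inj_on clique {..<10}"
    using inj_curve_form by (auto simp: inj_on_def clique_def)
  show "general_position (geometric_points base_points)" by (rule base_points_general_position)
  show "card (clique ` {..<10}) = 10" using card_image[OF inj] by simp
  show "\<forall>C\<in>clique ` {..<10}. irreducible_curve C"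
    using curve_form_properties(1) by (auto simp: clique_def simp del: irreducible_curve.simps) (metis prod_cases3)
  show "\<exists>x\<in>geometric_blowup base_points. \<forall>C\<in>clique ` {..<10}. x \<in> curve_points base_points C"
    using common_point by auto
  fix I assume I: "intersection_pairing base_points I"
  show "\<forall>C\<in>clique ` {..<10}. exceptional_curve base_points I C"
    using clique_intersections(2)[OF I] by auto
  show "\<forall>C\<in>clique ` {..<10}. \<forall>D\<in>clique ` {..<10}. C \<noteq> D \<longrightarrow> I (frag_of C) (frag_of D) \<in> {1, 2}"
    using clique_intersections(1)[OF I] by auto
  have eq: "clique a = clique b \<longleftrightarrow> a = b" if "a < 10" "b < 10" for a b
    using inj that by (auto simp: inj_on_def)
  have adj: "I (frag_of (clique a)) (frag_of (clique b)) = 2 \<longleftrightarrow> a div 3 = b div 3"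
    if "a < 10" "b < 10" "a \<noteq> b" for a b
    using clique_intersections(1)[OF I that(1,2)] that(3) by simp
  \<comment> \<open>For k = 0, 1, 2 these are the triangles; index 9 has quotient 3 and lies in none
    of them.\<close>
  define T where "T k = clique ` {a. a < 10 \<and> a div 3 = k}" for k
  have T_iff: "clique a \<in> T k \<longleftrightarrow> a div 3 = k" if "a < 10" for a k
    using that eq by (auto simp: T_def)
  have T: "T 0 = {clique 0, clique 1, clique 2}" "T 1 = {clique 3, clique 4, clique 5}"
    "T 2 = {clique 6, clique 7, clique 8}"
  proof -
    have "{a. a < 10 \<and> a div 3 = 0} = {0, 1, 2::nat}" "{a. a < 10 \<and> a div 3 = 1} = {3, 4, 5::nat}"
      "{a. a < 10 \<and> a div 3 = 2} = {6, 7, 8::nat}" by auto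
    then show "T 0 = {clique 0, clique 1, clique 2}" "T 1 = {clique 3, clique 4, clique 5}"
      "T 2 = {clique 6, clique 7, clique 8}" unfolding T_def by simp_all
  qed
  show "three_triangles_and_isolated_vertex (clique ` {..<10}) (\<lambda>C D. I (frag_of C) (frag_of D) = 2)"
    unfolding three_triangles_and_isolated_vertex_def
  proof (rule exI[of _ "T 0"], rule exI[of _ "T 1"], rule exI[of _ "T 2"], rule exI[of _ "clique 9"],
      intro conjI)
    have "{..<10::nat} = {0, 1, 2, 3, 4, 5, 6, 7, 8, 9}" by auto
    then show "clique ` {..<10} = T 0 \<union> T 1 \<union> T 2 \<union> {clique 9}"
      unfolding T by auto
    show "card (T 0) = 3" "card (T 1) = 3" "card (T 2) = 3"
      unfolding T by (simp_all add: eq)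
    show "T 0 \<inter> T 1 = {}" "T 0 \<inter> T 2 = {}" "T 1 \<inter> T 2 = {}" "clique 9 \<notin> T 0 \<union> T 1 \<union> T 2"
      unfolding T by (simp_all add: eq)
    show "\<forall>C\<in>clique ` {..<10}. \<forall>D\<in>clique ` {..<10}. C \<noteq> D \<longrightarrow>
        (I (frag_of C) (frag_of D) = 2) = (\<exists>S\<in>{T 0, T 1, T 2}. C \<in> S \<and> D \<in> S)"
    proof (intro ballI impI)
      fix C D assume "C \<in> clique ` {..<10}" "D \<in> clique ` {..<10}" "C \<noteq> D"
      then obtain a b where ab: "C = clique a" "D = clique b" "a < 10" "b < 10" "a \<noteq> b" by auto
      have three: "x = 0 \<or> x = 1 \<or> x = 2" if "x < 3" for x :: nat
        using that by linarith
      \<comment> \<open>Two different indices below 10 are not both 9, so a common quotient must be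
        0, 1 or 2.\<close>
      have "a < 9 \<or> b < 9" using ab(3-5) by linarith
      then have "a div 3 < 3 \<or> b div 3 < 3" by (auto intro: less_mult_imp_div_less)
      then have "a div 3 = b div 3 \<longleftrightarrow> a div 3 = 0 \<and> b div 3 = 0 \<or>
          a div 3 = 1 \<and> b div 3 = 1 \<or> a div 3 = 2 \<and> b div 3 = 2"
        using three[of "a div 3"] three[of "b div 3"] by metis
      then show "(I (frag_of C) (frag_of D) = 2) = (\<exists>S\<in>{T 0, T 1, T 2}. C \<in> S \<and> D \<in> S)"
        unfolding ab(1,2) adj[OF ab(3-5)] by (simp add: T_iff[OF ab(3)] T_iff[OF ab(4)])
    qed
  qed
qed

end
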